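(* Let $d\ge 3$ and let $w(t)$ be a real function decreasing to zero as $t\to+\infty$ such that $$\lim_{\delta\to 0}\ \sup_{t\ge 1}\frac{w(t)}{w((1+\delta)t)}=1$$ and such that the series $\sum_{\nu=1}^\infty \nu^{d-1}w(2^\nu)$ converges. Then for every $\varepsilon>0$ there exists a $d$-dimensional lattice $\Lambda\subset\mathbb{R}^d$ such that there are infinitely many ${\bf x}\in\Lambda$ with $\Pi^d({\bf x})\le(1+\varepsilon)\,w(|{\bf x}|)$, while the inequality $\Pi^d({\bf x})\le(1-\varepsilon)\,w(|{\bf x}|)$ is satisfied by only finitely many ${\bf x}\in\Lambda$.
   Context: For ${\bf x}=(x_1,\dots,x_d)^\top\in\mathbb{R}^d$, $|{\bf x}|=\max_{1\le i\le d}|x_i|$ and $\Pi^d({\bf x})=\prod_{i=1}^d|x_i|$. *)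

theory Defs
  imports "HOL-Analysis.Analysis"
begin

(* Injectivity makes range b consist of CARD('n) distinct vectors, so b is a basis and L has full rank. *)
definition is_lattice :: "(real ^ 'n) set \<Rightarrow> bool" where
  "is_lattice L \<longleftrightarrow>
    (\<exists>b :: 'n \<Rightarrow> real ^ 'n. inj b \<and> independent (range b) \<and>
       L = {\<Sum>i\<in>UNIV. of_int (c i) *\<^sub>R b i | c :: 'n \<Rightarrow> int. True})"

definition coord_prod :: "real ^ 'n \<Rightarrow> real" where
  "coord_prod x = (\<Prod>i\<in>UNIV. \<bar>x $ i\<bar>)"

end

theory Submission
  imports Defs
begin

text \<open>
  Start with a rank two lattice in a plane on which one coordinate is \<open>x \<theta> - y\<close>, where \<open>\<theta>\<close> is
  approximated by fractions \<open>p\<^sub>k / q\<^sub>k\<close> with \<open>q\<^sub>k \<theta> - p\<^sub>k\<close> close to \<open>1 / q\<^bsub>k+1\<^esub>\<close> and \<open>q\<^bsub>k+1\<^esub>\<close> close to \<open>q\<^sub>k\<^sup>d\<^sup>-\<^sup>1 / w(q\<^sub>k)\<close>, and the other \<open>d - 1\<close> coordinates are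
  pairwise independent, badly approximable forms that are asymptotically equal to \<open>q\<^sub>k\<close> at \<open>(q\<^sub>k, p\<^sub>k)\<close>. Then the
  coordinate product at \<open>(q\<^sub>k, p\<^sub>k)\<close> is asymptotic to \<open>w(q\<^sub>k)\<close>, while at a point \<open>(x, y)\<close> that is not a multiple of
  some \<open>(q\<^sub>k, p\<^sub>k)\<close> it is at least a constant times \<open>N\<^sup>d\<^sup>-\<^sup>2\<close>, \<open>N = max(|x|, |y|)\<close>, since only one coordinate is
  smaller than a multiple of \<open>N\<close>; this uses \<open>d \<ge> 3\<close>.

  The remaining \<open>d - 2\<close> basis vectors are added one at a time, each taken at random from a cube. For a
  sublattice \<open>L\<close> of smaller rank, the expected number of points \<open>l + m b\<close>, \<open>l \<in> L\<close>, \<open>1 \<le> m \<le> K\<close>, in a set \<open>S\<close> is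
  at most a constant times \<open>vol(S) (1 + ln K)\<close>. The points \<open>x\<close> with \<open>2\<^sup>\<nu> \<le> |x| < 2\<^sup>\<nu>\<^sup>+\<^sup>1\<close> whose coordinate
  product is at most \<open>w(2\<^sup>\<nu>)\<close> fill, up to a summable error, a volume of order \<open>\<nu>\<^sup>d\<^sup>-\<^sup>2 w(2\<^sup>\<nu>)\<close>, so the
  convergence of \<open>\<Sum> \<nu>\<^sup>d\<^sup>-\<^sup>1 w(2\<^sup>\<nu>)\<close> and the Borel-Cantelli argument leave only finitely many new points.
\<close>

subsection \<open>Integer spans\<close>

lemma infnorm_cart_le_iff: "infnorm (x :: real^'n) \<le> r \<longleftrightarrow> (\<forall>i. \<bar>x $ i\<bar> \<le> r)"
proof
  assume "\<forall>i. \<bar>x $ i\<bar> \<le> r"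
  then show "infnorm x \<le> r"
    unfolding infnorm_cart by (intro cSup_least) auto
qed (meson component_le_infnorm_cart order_trans)

lemma infnorm_attained: "\<exists>i. \<bar>x $ i\<bar> = infnorm (x :: real^'n)"
proof -
  have "Max (range (\<lambda>i. \<bar>x $ i\<bar>)) \<in> range (\<lambda>i. \<bar>x $ i\<bar>)"
    by (intro Max_in) auto
  moreover have "infnorm x = Max (range (\<lambda>i. \<bar>x $ i\<bar>))"
    unfolding infnorm_cart by (subst cSup_eq_Max) (auto simp: full_SetCompr_eq)
  ultimately show ?thesis by fastforce
qed

lemma inner_le_infnorm: "\<bar>a \<bullet> x\<bar> \<le> (\<Sum>i\<in>UNIV. \<bar>a $ i\<bar>) * infnorm (x :: real^'n)"
proof -
  have "\<bar>a \<bullet> x\<bar> \<le> (\<Sum>i\<in>UNIV. \<bar>a $ i * x $ i\<bar>)"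
    unfolding inner_vec_def by (simp add: sum_abs)
  also have "\<dots> \<le> (\<Sum>i\<in>UNIV. \<bar>a $ i\<bar> * infnorm x)"
    by (intro sum_mono) (simp add: abs_mult component_le_infnorm_cart mult_left_mono)
  finally show ?thesis by (simp add: sum_distrib_right)
qed

lemma continuous_on_coord_prod: "continuous_on A coord_prod"
  unfolding coord_prod_def by (intro continuous_intros)

lemma coord_prod_scaleR: "coord_prod (c *\<^sub>R x :: real^'n) = \<bar>c\<bar> ^ CARD('n) * coord_prod x"
  by (simp add: coord_prod_def abs_mult prod.distrib)

lemma coord_prod_nonneg: "coord_prod x \<ge> 0"
  by (simp add: coord_prod_def prod_nonneg)

text \<open>The coefficients are indexed by the vectors themselves instead of by \<open>'n\<close>,
  so the rank can be below the dimension and adjoining a vector is an \<open>insert\<close>.\<close>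

definition zspan :: "'a::real_vector set \<Rightarrow> 'a set" where
  "zspan B = {\<Sum>b\<in>B. of_int (c b) *\<^sub>R b | c :: 'a \<Rightarrow> int. True}"

lemma zspan_empty [simp]: "zspan {} = {0}"
  by (auto simp: zspan_def)

lemma zspan_subset_span: "zspan B \<subseteq> span B"
  unfolding zspan_def by clarify (rule span_sum, rule span_scale, erule span_base)

lemma zspan_insert:
  assumes "finite B" "b \<notin> B"
  shows "zspan (insert b B) = {of_int m *\<^sub>R b + l | m l. l \<in> zspan B}"
proof (intro equalityI subsetI)
  fix x assume "x \<in> zspan (insert b B)"
  then show "x \<in> {of_int m *\<^sub>R b + l | m l. l \<in> zspan B}"
    using assms by (auto simp: zspan_def)
next
  fix x assume "x \<in> {of_int m *\<^sub>R b + l | m l. l \<in> zspan B}"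
  then obtain m c where x: "x = of_int m *\<^sub>R b + (\<Sum>v\<in>B. of_int (c v) *\<^sub>R v)"
    by (auto simp: zspan_def)
  have "x = (\<Sum>v\<in>insert b B. of_int ((c(b := m)) v) *\<^sub>R v)"
    using assms x by (auto intro!: sum.cong)
  then show "x \<in> zspan (insert b B)"
    unfolding zspan_def by blast
qed

lemma zspan_uminus: "x \<in> zspan B \<Longrightarrow> - x \<in> zspan B"
proof -
  assume "x \<in> zspan B"
  then obtain c where "x = (\<Sum>v\<in>B. of_int (c v) *\<^sub>R v)"
    by (auto simp: zspan_def)
  then have "- x = (\<Sum>v\<in>B. of_int (- c v) *\<^sub>R v)"
    by (simp add: sum_negf)
  then show ?thesis
    unfolding zspan_def by (intro CollectI exI[of _ "\<lambda>v. - c v"]) simp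
qed

text \<open>The component of \<open>b\<close> orthogonal to \<open>span B\<close>, rescaled, reads
  off the coefficient \<open>m\<close> in \<open>m b + l\<close>; this is how coefficients get
  bounded by the size of a vector.\<close>

lemma orthogonal_functional:
  fixes b :: "'a::euclidean_space"
  assumes "b \<notin> span B"
  obtains a where "a \<bullet> b = 1" "\<And>l. l \<in> span B \<Longrightarrow> a \<bullet> l = 0"
proof -
  obtain y z where y: "y \<in> span B" and z: "\<And>w. w \<in> span B \<Longrightarrow> orthogonal z w" and b: "b = y + z"
    using orthogonal_subspace_decomp_exists[of B b] by blast
  have "z \<noteq> 0" using y b assms by auto
  have "z \<bullet> b = z \<bullet> z"
    using z[OF y] by (simp add: b inner_add_right orthogonal_def)
  then show thesis
    using \<open>z \<noteq> 0\<close> z by (intro that[of "z /\<^sub>R (z \<bullet> z)"]) (auto simp: orthogonal_def)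
qed

lemma ints_near:
  fixes t s :: real
  assumes "s \<ge> 0"
  shows "finite {m::int. \<bar>of_int m - t\<bar> \<le> s}" "card {m::int. \<bar>of_int m - t\<bar> \<le> s} \<le> 2 * s + 1"
proof -
  have eq: "{m::int. \<bar>of_int m - t\<bar> \<le> s} = {\<lceil>t - s\<rceil>..\<lfloor>t + s\<rfloor>}"
    by (auto simp: abs_le_iff ceiling_le_iff le_floor_iff)
  show "finite {m::int. \<bar>of_int m - t\<bar> \<le> s}" by (simp add: eq)
  show "card {m::int. \<bar>of_int m - t\<bar> \<le> s} \<le> 2 * s + 1"
    unfolding eq using assms by simp linarith
qed

text \<open>Induction on the rank: the functional reading off the coefficient of the new vector
  confines it to an interval of length proportional to \<open>n\<close>, and each value leaves a
  recentred count of smaller rank. The constant is the same for all centres \<open>x\<close>, as the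
  averaging in \<open>emeasure_hit\<close> needs.\<close>

lemma card_zspan_near:
  fixes B :: "(real^'n) set"
  assumes "finite B" "independent B"
  shows "\<exists>C\<ge>0. \<forall>x. \<forall>n\<ge>1. finite {l \<in> zspan B. infnorm (l - x) \<le> n} \<and>
           real (card {l \<in> zspan B. infnorm (l - x) \<le> n}) \<le> C * n ^ card B"
  using assms
proof (induction B rule: finite_induct)
  case empty
  have "finite {l \<in> zspan {}. infnorm (l - x) \<le> n} \<and>
           real (card {l \<in> zspan {}. infnorm (l - x) \<le> n}) \<le> 1" for x :: "real^'n" and n
    using card_mono[of "{0}" "{l \<in> zspan {}. infnorm (l - x) \<le> n}"]
    by (auto intro: finite_subset[of _ "{0}"])
  then show ?case by (intro exI[of _ 1]) simp
next
  case (insert b B)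
  then have ind: "independent B" "b \<notin> span B"
    using insert by (auto simp: independent_insert)
  then obtain C where C: "C \<ge> 0"
    "\<And>x n. n \<ge> 1 \<Longrightarrow> finite {l \<in> zspan B. infnorm (l - x) \<le> n}"
    "\<And>x n. n \<ge> 1 \<Longrightarrow> real (card {l \<in> zspan B. infnorm (l - x) \<le> n}) \<le> C * n ^ card B"
    using insert.IH by blast
  obtain a where a: "a \<bullet> b = 1" "\<And>l. l \<in> span B \<Longrightarrow> a \<bullet> l = 0"
    using orthogonal_functional[OF ind(2)] by blast
  define K where "K = (\<Sum>i\<in>UNIV. \<bar>a $ i\<bar>)"
  have K0: "K \<ge> 0" by (simp add: K_def sum_nonneg)
  show ?case
  proof (intro exI[of _ "(2 * K + 1) * C"] conjI allI impI)
    show "0 \<le> (2 * K + 1) * C" using K0 C(1) by simp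
    fix x :: "real^'n" and n :: real assume n: "n \<ge> 1"
    define M where "M = {m::int. \<bar>of_int m - a \<bullet> x\<bar> \<le> K * n}"
    define T where "T m = {l \<in> zspan B. infnorm (l - (x - of_int m *\<^sub>R b)) \<le> n}" for m :: int
    have Kn: "K * n \<ge> 0" using K0 n by simp
    have M: "finite M" "real (card M) \<le> (2 * K + 1) * n"
    proof -
      show "finite M" using ints_near[OF Kn, of "a \<bullet> x"] by (auto simp: M_def)
      \<comment> \<open>The summand 1 is absorbed into a multiple of \<open>n\<close> because
        \<open>n >= 1\<close>.\<close>
      have "real (card M) \<le> 2 * (K * n) + 1"
        using ints_near[OF Kn, of "a \<bullet> x"] by (simp add: M_def)
      then show "real (card M) \<le> (2 * K + 1) * n" using n by (simp add: algebra_simps)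
    qed
    have sub: "{l \<in> zspan (insert b B). infnorm (l - x) \<le> n}
        \<subseteq> (\<Union>m\<in>M. (\<lambda>l. of_int m *\<^sub>R b + l) ` T m)"
    proof
      fix y assume "y \<in> {l \<in> zspan (insert b B). infnorm (l - x) \<le> n}"
      then obtain m l where y: "y = of_int m *\<^sub>R b + l" "l \<in> zspan B" "infnorm (y - x) \<le> n"
        using zspan_insert[OF insert.hyps(1,2)] by auto
      have "a \<bullet> (y - x) = of_int m - a \<bullet> x"
        using y(2) a zspan_subset_span[of B] by (auto simp: y(1) inner_diff_right inner_add_right)
      then have "\<bar>of_int m - a \<bullet> x\<bar> \<le> K * infnorm (y - x)"
        using inner_le_infnorm[of a "y - x"] by (simp add: K_def)
      also have "\<dots> \<le> K * n" using y(3) K0 by (simp add: mult_left_mono)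
      finally have "m \<in> M" by (simp add: M_def)
      moreover have "l \<in> T m"
        using y by (simp add: T_def algebra_simps)
      ultimately show "y \<in> (\<Union>m\<in>M. (\<lambda>l. of_int m *\<^sub>R b + l) ` T m)"
        using y(1) by blast
    qed
    have finT: "finite (T m)" "real (card (T m)) \<le> C * n ^ card B" for m
      unfolding T_def using C(2,3)[OF n, of "x - of_int m *\<^sub>R b"] by auto
    have finU: "finite (\<Union>m\<in>M. (\<lambda>l. of_int m *\<^sub>R b + l) ` T m)"
      using M finT by auto
    show "finite {l \<in> zspan (insert b B). infnorm (l - x) \<le> n}"
      by (rule finite_subset[OF sub finU])
    have "real (card {l \<in> zspan (insert b B). infnorm (l - x) \<le> n})
        \<le> real (card (\<Union>m\<in>M. (\<lambda>l. of_int m *\<^sub>R b + l) ` T m))"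
      using card_mono[OF finU sub] by simp
    also have "\<dots> \<le> real (\<Sum>m\<in>M. card ((\<lambda>l. of_int m *\<^sub>R b + l) ` T m))"
      using card_UN_le[OF M(1)] of_nat_le_iff by blast
    also have "\<dots> \<le> (\<Sum>m\<in>M. C * n ^ card B)"
      unfolding of_nat_sum
    proof (intro sum_mono)
      fix m
      have "card ((\<lambda>l. of_int m *\<^sub>R b + l) ` T m) \<le> card (T m)"
        using finT(1) by (rule card_image_le)
      then show "real (card ((\<lambda>l. of_int m *\<^sub>R b + l) ` T m)) \<le> C * n ^ card B"
        using finT(2)[of m] by linarith
    qed
    also have "\<dots> \<le> ((2 * K + 1) * n) * (C * n ^ card B)"
      using M(2) C(1) n by (auto intro!: mult_right_mono)
    also have "\<dots> = (2 * K + 1) * C * n ^ card (insert b B)"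
      using insert.hyps by (simp add: algebra_simps)
    finally show "real (card {l \<in> zspan (insert b B). infnorm (l - x) \<le> n})
        \<le> (2 * K + 1) * C * n ^ card (insert b B)" .
  qed
qed

lemma finite_zspan_infnorm_le:
  fixes B :: "(real^'n) set"
  assumes "finite B" "independent B"
  shows "finite {l \<in> zspan B. infnorm l \<le> r}"
proof -
  have "(1::real) \<le> max 1 r" by simp
  then have "finite {l \<in> zspan B. infnorm (l - 0) \<le> max 1 r}"
    using card_zspan_near[OF assms] by blast
  then show ?thesis by (rule rev_finite_subset) auto
qed

section \<open>Measure of the vectors \<open>b\<close> for which some \<open>l + m b\<close> falls
  in a given set\<close>

lemma emeasure_lborel_vimage_affine:
  fixes t :: "'a::euclidean_space"
  assumes "c > 0" "S \<in> sets borel"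
  shows "emeasure lborel {b. t + c *\<^sub>R b \<in> S} = ennreal (1 / c ^ DIM('a)) * emeasure lborel S"
proof -
  have m: "(\<lambda>x::'a. t + c *\<^sub>R x) \<in> borel_measurable borel" by simp
  have v: "(\<lambda>x. t + c *\<^sub>R x) -` S = {b. t + c *\<^sub>R b \<in> S}" by auto
  have "emeasure lborel S
      = emeasure (density (distr lborel borel (\<lambda>x. t + c *\<^sub>R x)) (\<lambda>_. \<bar>c\<bar> ^ DIM('a))) S"
    using lborel_affine[of c t] assms(1) by simp
  also have "\<dots> = ennreal (c ^ DIM('a)) * emeasure lborel {b. t + c *\<^sub>R b \<in> S}"
    using assms by (simp add: emeasure_density nn_integral_cmult emeasure_distr v)
  finally have "emeasure lborel S = ennreal (c ^ DIM('a)) * emeasure lborel {b. t + c *\<^sub>R b \<in> S}" .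
  then show ?thesis
    using assms(1) by (simp add: mult.assoc[symmetric] ennreal_mult[symmetric])
qed

text \<open>Let \<open>d = CARD('n)\<close>. Substituting \<open>x = l + m b\<close>, each
  \<open>l\<close> contributes \<open>m^(-d)\<close> times the volume of the part of
  \<open>S\<close> in the cube of radius \<open>m\<close> around \<open>l + m b0\<close>. A point
  \<open>x\<close> lies in at most \<open>C m^(d-1)\<close> of these cubes, so summing over
  \<open>l\<close> leaves \<open>C / m\<close> times the volume of \<open>S\<close>.\<close>

lemma emeasure_hit:
  fixes L :: "(real^'n) set" and b0 :: "real^'n" and m :: nat
  assumes count: "\<And>x n. n \<ge> 1 \<Longrightarrow> finite {l \<in> L. infnorm (l - x) \<le> n}"
      "\<And>x n. n \<ge> 1 \<Longrightarrow> real (card {l \<in> L. infnorm (l - x) \<le> n}) \<le> C * n ^ (CARD('n) - 1)"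
    and S: "S \<in> sets borel" "bounded S" and m: "m \<ge> 1" and C: "C \<ge> 0"
  shows "{b. infnorm (b - b0) \<le> 1 \<and> (\<exists>l\<in>L. l + real m *\<^sub>R b \<in> S)} \<in> sets borel" (is "?H \<in> _")
    and "emeasure lborel {b. infnorm (b - b0) \<le> 1 \<and> (\<exists>l\<in>L. l + real m *\<^sub>R b \<in> S)}
      \<le> ennreal (C / m) * emeasure lborel S"
proof -
  obtain r where r: "\<And>x. x \<in> S \<Longrightarrow> norm x \<le> r" using S(2) by (auto simp: bounded_iff)
  \<comment> \<open>Only these finitely many \<open>l\<close> can carry the cube into
    \<open>S\<close>, since norms in \<open>S\<close> are at most \<open>r\<close>;
    \<open>max 1\<close> meets the radius condition in \<open>count\<close>.\<close>
  define F where "F = {l \<in> L. infnorm (l - (- real m *\<^sub>R b0)) \<le> max 1 (r + m)}"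
  define D where "D l = {x \<in> S. infnorm (x - l - real m *\<^sub>R b0) \<le> m}" for l
  have finF: "finite F" unfolding F_def by (rule count) simp
  have iff: "infnorm (b - b0) \<le> 1 \<longleftrightarrow> infnorm (l + real m *\<^sub>R b - l - real m *\<^sub>R b0) \<le> m" for b l
  proof -
    have "l + real m *\<^sub>R b - l - real m *\<^sub>R b0 = real m *\<^sub>R (b - b0)" by (simp add: algebra_simps)
    then show ?thesis using m by (simp add: infnorm_mul)
  qed
  have D_meas [measurable]: "D l \<in> sets borel" for l
  proof -
    have "closed {x. infnorm (x - l - real m *\<^sub>R b0) \<le> m}"
      by (intro closed_Collect_le continuous_intros)
    moreover have "D l = S \<inter> {x. infnorm (x - l - real m *\<^sub>R b0) \<le> m}"
      by (auto simp: D_def)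
    ultimately show ?thesis using S(1) by (simp add: borel_closed sets.Int)
  qed
  have in_F: "l \<in> F" if "l \<in> L" "x \<in> D l" for l x
  proof -
    have "infnorm (l - (- real m *\<^sub>R b0)) = infnorm (x + - (x - l - real m *\<^sub>R b0))"
      by (simp add: algebra_simps)
    also have "\<dots> \<le> infnorm x + infnorm (x - l - real m *\<^sub>R b0)"
      by (metis infnorm_triangle infnorm_neg)
    also have "\<dots> \<le> r + m"
      using that(2) r[of x] infnorm_le_norm[of x] by (auto simp: D_def)
    finally show ?thesis using that(1) by (simp add: F_def)
  qed
  have eq: "?H = (\<Union>l\<in>F. {b. l + real m *\<^sub>R b \<in> D l})"
  proof (intro equalityI subsetI)
    fix b assume "b \<in> ?H"
    then obtain l where l: "infnorm (b - b0) \<le> 1" "l \<in> L" "l + real m *\<^sub>R b \<in> S" by blast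
    have "l + real m *\<^sub>R b \<in> D l"
      using l(1,3) iff[of b l] unfolding D_def by blast
    then show "b \<in> (\<Union>l\<in>F. {b. l + real m *\<^sub>R b \<in> D l})"
      using in_F[OF l(2)] by blast
  next
    fix b assume "b \<in> (\<Union>l\<in>F. {b. l + real m *\<^sub>R b \<in> D l})"
    then obtain l where l: "l \<in> L" "l + real m *\<^sub>R b \<in> D l" by (auto simp: F_def)
    then show "b \<in> ?H"
      using iff[of b l] unfolding D_def by blast
  qed
  have meas: "{b. l + real m *\<^sub>R b \<in> D l} \<in> sets borel" for l
    using measurable_sets[of "\<lambda>b. l + real m *\<^sub>R b" borel borel "D l"] by (simp add: vimage_def)
  show "?H \<in> sets borel"
    unfolding eq using finF meas by blast
  have "emeasure lborel ?H \<le> (\<Sum>l\<in>F. emeasure lborel {b. l + real m *\<^sub>R b \<in> D l})"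
    unfolding eq using finF meas by (intro emeasure_subadditive_finite) auto
  also have "\<dots> = ennreal (1 / m ^ CARD('n)) * (\<Sum>l\<in>F. emeasure lborel (D l))"
    using m by (simp add: emeasure_lborel_vimage_affine sum_distrib_left)
  \<comment> \<open>The sum of the volumes is the integral of the overlap number, which the lattice
    count bounds pointwise.\<close>
  also have "(\<Sum>l\<in>F. emeasure lborel (D l)) = (\<integral>\<^sup>+x. (\<Sum>l\<in>F. indicator (D l) x) \<partial>lborel)"
    by (subst nn_integral_sum) auto
  also have "\<dots> \<le> (\<integral>\<^sup>+x. ennreal (C * m ^ (CARD('n) - 1)) * indicator S x \<partial>lborel)"
  proof (intro nn_integral_mono)
    fix x :: "real^'n"
    let ?A = "{l \<in> L. infnorm (l - (x - real m *\<^sub>R b0)) \<le> m}"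
    have A: "{l \<in> F. x \<in> D l} \<subseteq> ?A"
    proof
      fix l assume "l \<in> {l \<in> F. x \<in> D l}"
      then have "l \<in> L" "infnorm (x - l - real m *\<^sub>R b0) \<le> m"
        by (auto simp: F_def D_def)
      moreover have "l - (x - real m *\<^sub>R b0) = - (x - l - real m *\<^sub>R b0)" by simp
      ultimately show "l \<in> ?A" by (simp only: infnorm_neg mem_Collect_eq)
    qed
    have "(\<Sum>l\<in>F. indicator (D l) x :: ennreal) = of_nat (card {l \<in> F. x \<in> D l})"
      using finF by (simp add: indicator_def sum.If_cases Int_def)
    also have "\<dots> \<le> ennreal (C * m ^ (CARD('n) - 1)) * indicator S x"
    proof (cases "x \<in> S")
      case True
      have "real (card {l \<in> F. x \<in> D l}) \<le> real (card ?A)"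
        using card_mono[OF count(1) A] m by simp
      also have "\<dots> \<le> C * m ^ (CARD('n) - 1)"
        using count(2)[of "real m"] m by simp
      finally show ?thesis using True by (simp add: ennreal_of_nat_eq_real_of_nat ennreal_leI)
    qed (simp add: D_def)
    finally show "(\<Sum>l\<in>F. indicator (D l) x :: ennreal) \<le> ennreal (C * m ^ (CARD('n) - 1)) * indicator S x" .
  qed
  also have "\<dots> = ennreal (C * m ^ (CARD('n) - 1)) * emeasure lborel S"
    using S(1) by (simp add: nn_integral_cmult)
  also have "ennreal (1 / m ^ CARD('n)) * (ennreal (C * m ^ (CARD('n) - 1)) * emeasure lborel S)
      = ennreal (1 / m ^ CARD('n) * (C * m ^ (CARD('n) - 1))) * emeasure lborel S"
  proof -
    have "ennreal s * (ennreal t * e) = ennreal (s * t) * e" if "s \<ge> 0" "t \<ge> 0" for s t e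
      by (simp add: ennreal_mult that mult.assoc)
    then show ?thesis using C by simp
  qed
  also have "1 / m ^ CARD('n) * (C * m ^ (CARD('n) - 1)) = C / m"
    using m power_minus_mult[of "CARD('n)" "real m"] by (simp add: field_simps)
  finally show "emeasure lborel ?H \<le> ennreal (C / m) * emeasure lborel S"
    by (simp add: mult_left_mono)
qed

lemma sum_inverse_le_ln:
  "K \<ge> 1 \<Longrightarrow> (\<Sum>m=1..K. 1 / real m) \<le> 1 + ln K"
proof (induction K rule: dec_induct)
  case (step K)
  have "ln (real K / real (Suc K)) \<le> real K / real (Suc K) - 1"
    using step by (intro ln_le_minus_one) auto
  then have "1 / real (Suc K) \<le> ln (Suc K) - ln K"
    using step by (simp add: ln_div field_simps)
  then show ?case using step by simp
qed simp

subsection \<open>Volume of the region of small coordinate product\<close>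

lemma emeasure_centered_box:
  fixes r :: "'n::finite \<Rightarrow> real"
  assumes "\<And>j. r j \<ge> 0"
  shows "emeasure lborel {x :: real^'n. \<forall>j. \<bar>x $ j\<bar> \<le> r j} = ennreal (\<Prod>j\<in>UNIV. 2 * r j)"
    and "closed {x :: real^'n. \<forall>j. \<bar>x $ j\<bar> \<le> r j}"
proof -
  have eq: "{x :: real^'n. \<forall>j. \<bar>x $ j\<bar> \<le> r j} = cbox (\<chi> j. - r j) (\<chi> j. r j)"
    by (auto simp: mem_box_cart abs_le_iff minus_le_iff)
  have "0 \<in> cbox (\<chi> j. - r j) (\<chi> j. r j)"
    using assms by (simp add: mem_box_cart)
  then have "cbox (\<chi> j. - r j) (\<chi> j. r j) \<noteq> {}" by blast
  then have "measure lborel (cbox (\<chi> j. - r j) (\<chi> j. r j)) = (\<Prod>j\<in>UNIV. 2 * r j)"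
    by (simp add: content_cbox_cart)
  then show "emeasure lborel {x :: real^'n. \<forall>j. \<bar>x $ j\<bar> \<le> r j} = ennreal (\<Prod>j\<in>UNIV. 2 * r j)"
    unfolding eq by (metis emeasure_eq_ennreal_measure emeasure_lborel_cbox_finite less_irrefl infinity_ennreal_def)
  show "closed {x :: real^'n. \<forall>j. \<bar>x $ j\<bar> \<le> r j}" unfolding eq by (rule closed_cbox)
qed

lemma prod_split2:
  fixes f :: "'n::finite \<Rightarrow> 'a::comm_monoid_mult"
  assumes "i \<noteq> j"
  shows "prod f UNIV = f i * (f j * prod f (UNIV - {i, j}))"
proof -
  have "UNIV = insert i (insert j (UNIV - {i, j}))" by auto
  then have "prod f UNIV = prod f (insert i (insert j (UNIV - {i, j})))" by simp
  also have "\<dots> = f i * (f j * prod f (UNIV - {i, j}))"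
    using assms by (subst prod.insert; simp)+
  finally show ?thesis .
qed

text \<open>
  Fixing the maximal coordinate, one further index, and the dyadic scales of the remaining
  \<open>d - 2\<close> coordinates leaves a box of volume proportional to \<open>W\<close>; this gives the exponent
  \<open>d - 2\<close>.
\<close>
lemma emeasure_small_coord_prod_shell:
  assumes "CARD('n::finite) \<ge> 2"
  shows "\<exists>C\<ge>0. \<forall>\<nu>::nat\<ge>1. \<forall>W\<ge>0.
    emeasure lborel {x :: real^'n. 2 ^ \<nu> \<le> infnorm x \<and> infnorm x < 2 ^ (\<nu> + 1) \<and> coord_prod x \<le> W}
      \<le> ennreal (C * (real \<nu> ^ (CARD('n) - 2) * W + (1/2) ^ \<nu>))"
proof -
  define d where "d = CARD('n)"
  have d: "d \<ge> 2" using assms by (simp add: d_def)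
  have "\<exists>g. \<forall>j::'n. g j \<noteq> j"
  proof -
    have "\<exists>i. i \<noteq> j" for j :: 'n
    proof (rule ccontr)
      assume "\<nexists>i. i \<noteq> j"
      then have "(UNIV :: 'n set) = {j}" by blast
      then have "CARD('n) = 1" by (metis card_1_singleton_iff One_nat_def)
      then show False using assms by simp
    qed
    then show ?thesis by metis
  qed
  \<comment> \<open>The coordinate \<open>g j\<close> gets no dyadic scale of its own; it is bounded
    through the product.\<close>
  then obtain g :: "'n \<Rightarrow> 'n" where g: "\<And>j. g j \<noteq> j" by blast
  have card_rest: "card (UNIV - {j, g j}) = d - 2" for j :: 'n
    using g[of j] by (subst card_Diff_subset) (auto simp: d_def)
  show ?thesis
  proof (intro exI conjI allI impI)
    \<comment> \<open>There are \<open>d\<close> choices of \<open>j\<close>, each box has volume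
      \<open>2^(2d-1)\<close> times \<open>W\<close> or \<open>2^(-\<nu>)\<close>, and there are at
      most \<open>((d+2) \<nu>)^(d-2)\<close> vectors of scales.\<close>
    define C where "C = real d * 2 ^ (2 * d - 1) * real (d + 2) ^ (d - 2)"
    show "C \<ge> 0" by (simp add: C_def)
    fix \<nu> :: nat and W :: real assume \<nu>: "\<nu> \<ge> 1" and W: "W \<ge> 0"
    let ?S = "{x :: real^'n. 2 ^ \<nu> \<le> infnorm x \<and> infnorm x < 2 ^ (\<nu> + 1) \<and> coord_prod x \<le> W}"
    define Q where "Q r = {x :: real^'n. \<forall>j. \<bar>x $ j\<bar> \<le> r j}" for r :: "'n \<Rightarrow> real"
    \<comment> \<open>These boxes cover the points with a coordinate of size at most
      \<open>2^(-d \<nu>)\<close>; their volume is of order \<open>2^(-\<nu>)\<close> and makes up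
      the error term. For all other points each dyadic exponent takes only O(\<nu>) values,
      collected in \<open>A\<close>.\<close>
    define R1 where "R1 j = (\<lambda>i. if i = j then (1/2 :: real) ^ (d * \<nu>) else 2 ^ (\<nu> + 1))" for j :: 'n
    define A where "A j = (UNIV - {j, g j}) \<rightarrow>\<^sub>E {- int (d * \<nu>)..int \<nu>}" for j :: 'n
    define P where "P j a = (\<Prod>i\<in>UNIV - {j, g j}. (2::real) powr of_int (a i))" for j :: 'n and a :: "'n \<Rightarrow> int"
    \<comment> \<open>At scales \<open>a\<close> the product is at least \<open>2^\<nu> P\<close>
      times the coordinate \<open>g j\<close>, which gives the bound for that coordinate;
      \<open>P\<close> then cancels from the volume of the box.\<close>
    define R2 where "R2 j a = (\<lambda>i. if i = j then 2 ^ (\<nu> + 1) else if i = g j then W / (2 ^ \<nu> * P j a)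
        else 2 * 2 powr of_int (a i))" for j :: 'n and a :: "'n \<Rightarrow> int"
    have P: "P j a > 0" for j a by (simp add: P_def prod_pos)
    have R1: "R1 j i \<ge> 0" for j i by (simp add: R1_def)
    have R2: "R2 j a i \<ge> 0" for j a i using P[of j a] W by (simp add: R2_def)
    have finA: "finite (A j)" for j unfolding A_def by (intro finite_PiE) auto
    have "card {- int (d * \<nu>)..int \<nu>} = d * \<nu> + \<nu> + 1"
      unfolding card_atLeastAtMost_int by linarith
    then have "card (A j) = (d * \<nu> + \<nu> + 1) ^ (d - 2)" for j
      unfolding A_def by (subst card_PiE) (simp_all only: card_rest prod_constant finite)
    moreover have "d * \<nu> + \<nu> + 1 \<le> (d + 2) * \<nu>" using \<nu> by (simp add: algebra_simps)
    ultimately have cardA: "card (A j) \<le> ((d + 2) * \<nu>) ^ (d - 2)" for j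
      by (simp only: power_mono zero_le)
    have sub: "?S \<subseteq> (\<Union>j. Q (R1 j)) \<union> (\<Union>j. \<Union>a\<in>A j. Q (R2 j a))"
    proof
      fix x :: "real^'n" assume x: "x \<in> ?S"
      then have up: "\<bar>x $ i\<bar> \<le> 2 ^ (\<nu> + 1)" "\<bar>x $ i\<bar> < 2 ^ (\<nu> + 1)" for i
        using component_le_infnorm_cart[of x i] by auto
      show "x \<in> (\<Union>j. Q (R1 j)) \<union> (\<Union>j. \<Union>a\<in>A j. Q (R2 j a))"
      proof (cases "\<exists>j. \<bar>x $ j\<bar> \<le> (1/2) ^ (d * \<nu>)")
        case True
        then obtain j where "\<bar>x $ j\<bar> \<le> (1/2) ^ (d * \<nu>)" by blast
        then have "x \<in> Q (R1 j)" using up by (auto simp: Q_def R1_def)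
        then show ?thesis by blast
      next
        case False
        then have lo: "\<bar>x $ i\<bar> > (1/2) ^ (d * \<nu>)" for i by (simp add: not_le)
        have pos: "\<bar>x $ i\<bar> > 0" for i using lo[of i] by (smt (verit) zero_le_power divide_nonneg_nonneg)
        obtain j where j: "\<bar>x $ j\<bar> = infnorm x" using infnorm_attained by blast
        define a where "a = (\<lambda>i\<in>UNIV - {j, g j}. \<lfloor>log 2 \<bar>x $ i\<bar>\<rfloor>)"
        have aA: "a \<in> A j"
        proof -
          have "- int (d * \<nu>) \<le> \<lfloor>log 2 \<bar>x $ i\<bar>\<rfloor>" "\<lfloor>log 2 \<bar>x $ i\<bar>\<rfloor> \<le> int \<nu>" for i
          proof -
            have "(1/2::real) ^ (d * \<nu>) = 2 powr (- real (d * \<nu>))"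
              by (simp only: powr_minus_divide powr_realpow zero_less_numeral power_one_over)
            then have "- real (d * \<nu>) \<le> log 2 \<bar>x $ i\<bar>"
              using lo[of i] pos[of i] by (subst le_log_iff) auto
            then show "- int (d * \<nu>) \<le> \<lfloor>log 2 \<bar>x $ i\<bar>\<rfloor>" by (simp add: le_floor_iff)
            have "\<bar>x $ i\<bar> < 2 powr real (\<nu> + 1)"
              using up(2)[of i] by (simp only: powr_realpow zero_less_numeral)
            then have "log 2 \<bar>x $ i\<bar> < real (\<nu> + 1)"
              using pos[of i] by (subst log_less_iff) auto
            then show "\<lfloor>log 2 \<bar>x $ i\<bar>\<rfloor> \<le> int \<nu>" by linarith
          qed
          then show ?thesis by (auto simp: A_def a_def)
        qed
        have fl: "2 powr of_int \<lfloor>log 2 \<bar>x $ i\<bar>\<rfloor> \<le> \<bar>x $ i\<bar>" "\<bar>x $ i\<bar> \<le> 2 * 2 powr of_int \<lfloor>log 2 \<bar>x $ i\<bar>\<rfloor>" for i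
        proof -
          have x: "\<bar>x $ i\<bar> = 2 powr log 2 \<bar>x $ i\<bar>" using pos[of i] by simp
          have "2 powr of_int \<lfloor>log 2 \<bar>x $ i\<bar>\<rfloor> \<le> 2 powr log 2 \<bar>x $ i\<bar>"
            by (intro powr_mono) auto
          then show "2 powr of_int \<lfloor>log 2 \<bar>x $ i\<bar>\<rfloor> \<le> \<bar>x $ i\<bar>" using x by simp
          have "2 powr log 2 \<bar>x $ i\<bar> \<le> 2 powr (1 + of_int \<lfloor>log 2 \<bar>x $ i\<bar>\<rfloor>)"
            by (intro powr_mono) linarith+
          then show "\<bar>x $ i\<bar> \<le> 2 * 2 powr of_int \<lfloor>log 2 \<bar>x $ i\<bar>\<rfloor>" using x by (simp add: powr_add)
        qed
        have "2 ^ \<nu> * P j a * \<bar>x $ g j\<bar> \<le> coord_prod x"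
        proof -
          have "P j a \<le> (\<Prod>i\<in>UNIV - {j, g j}. \<bar>x $ i\<bar>)"
            unfolding P_def a_def using fl by (intro prod_mono) auto
          moreover have "2 ^ \<nu> \<le> \<bar>x $ j\<bar>" using j x by simp
          ultimately have "2 ^ \<nu> * P j a \<le> \<bar>x $ j\<bar> * (\<Prod>i\<in>UNIV - {j, g j}. \<bar>x $ i\<bar>)"
            using P[of j a] by (intro mult_mono) auto
          then have "2 ^ \<nu> * P j a * \<bar>x $ g j\<bar> \<le> \<bar>x $ j\<bar> * (\<Prod>i\<in>UNIV - {j, g j}. \<bar>x $ i\<bar>) * \<bar>x $ g j\<bar>"
            by (intro mult_right_mono) auto
          then show ?thesis
            unfolding coord_prod_def using g[of j] by (subst prod_split2[of j "g j"]) (auto simp: mult_ac)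
        qed
        then have "\<bar>x $ g j\<bar> \<le> W / (2 ^ \<nu> * P j a)"
          using x P[of j a] by (simp add: field_simps)
        moreover have "\<bar>x $ i\<bar> \<le> 2 * 2 powr of_int (a i)" if "i \<noteq> j" "i \<noteq> g j" for i
          using fl(2)[of i] that by (simp add: a_def)
        ultimately have "x \<in> Q (R2 j a)"
          using up(1) by (auto simp: Q_def R2_def)
        then show ?thesis using aA by blast
      qed
    qed
    have volR1: "(\<Prod>i\<in>UNIV. 2 * R1 j i) = 2 ^ (2 * d - 1) * (1/2) ^ \<nu>" for j
    proof -
      have "(\<Prod>i\<in>UNIV - {j}. R1 j i) = (\<Prod>i\<in>UNIV - {j}. 2 ^ (\<nu> + 1))"
        by (intro prod.cong) (auto simp: R1_def)
      then have "(\<Prod>i\<in>UNIV. 2 * R1 j i) = 2 ^ d * ((1/2) ^ (d * \<nu>) * (2 ^ (\<nu> + 1)) ^ (d - 1))"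
        by (simp add: prod.distrib d_def prod.remove[of UNIV j "R1 j"]) (simp add: R1_def d_def)
      also have "\<dots> = 2 ^ (2 * d - 1) * (1/2) ^ \<nu>"
      proof -
        obtain e where e: "d = Suc e" using d by (cases d) auto
        have h: "(2::real) ^ n * (1/2) ^ n = 1" for n by (simp add: power_mult_distrib[symmetric])
        have "(2::real) ^ d * ((1/2) ^ (d * \<nu>) * (2 ^ (\<nu> + 1)) ^ (d - 1))
          = 2 ^ Suc e * ((1/2) ^ \<nu> * (2 ^ (e * \<nu>) * (1/2) ^ (e * \<nu>)) * 2 ^ e)"
          by (simp add: e power_add power_mult_distrib power_mult[symmetric] mult_ac)
        also have "\<dots> = 2 ^ Suc e * 2 ^ e * (1/2) ^ \<nu>" unfolding h by simp
        also have "\<dots> = 2 ^ (Suc e + e) * (1/2) ^ \<nu>" by (simp only: power_add)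
        also have "Suc e + e = 2 * d - 1" by (simp add: e)
        finally show ?thesis .
      qed
      finally show ?thesis .
    qed
    have volR2: "(\<Prod>i\<in>UNIV. 2 * R2 j a i) = 2 ^ (2 * d - 1) * W" for j a
    proof -
      have "(\<Prod>i\<in>UNIV - {j, g j}. R2 j a i) = (\<Prod>i\<in>UNIV - {j, g j}. 2 * 2 powr of_int (a i))"
        by (intro prod.cong) (auto simp: R2_def)
      also have "\<dots> = 2 ^ (d - 2) * P j a"
        by (simp only: prod.distrib P_def prod_constant card_rest)
      finally have rest: "(\<Prod>i\<in>UNIV - {j, g j}. R2 j a i) = 2 ^ (d - 2) * P j a" .
      have "(\<Prod>i\<in>UNIV. 2 * R2 j a i) = 2 ^ d * (\<Prod>i\<in>UNIV. R2 j a i)"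
        by (simp add: prod.distrib d_def)
      also have "(\<Prod>i\<in>UNIV. R2 j a i) = 2 ^ (\<nu> + 1) * (W / (2 ^ \<nu> * P j a) * (2 ^ (d - 2) * P j a))"
        unfolding prod_split2[OF g[of j, symmetric]] rest using g[of j] by (simp add: R2_def)
      also have "\<dots> = 2 * 2 ^ (d - 2) * W" using P[of j a] by (simp add: field_simps)
      also have "2 ^ d * (2 * 2 ^ (d - 2) * W) = 2 ^ (d + 1 + (d - 2)) * W"
        by (simp add: power_add)
      also have "d + 1 + (d - 2) = 2 * d - 1" using d by simp
      finally show ?thesis .
    qed
    have emQ1: "emeasure lborel (Q (R1 j)) = ennreal (2 ^ (2 * d - 1) * (1/2) ^ \<nu>)" for j
      unfolding Q_def using emeasure_centered_box(1)[of "R1 j"] R1 volR1 by simp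
    have emQ2: "emeasure lborel (Q (R2 j a)) = ennreal (2 ^ (2 * d - 1) * W)" for j a
      unfolding Q_def using emeasure_centered_box(1)[of "R2 j a"] R2 volR2 by simp
    have Qm1: "Q (R1 j) \<in> sets lborel" for j
      unfolding Q_def using emeasure_centered_box(2)[of "R1 j"] R1 by (simp add: borel_closed)
    have Qm2: "Q (R2 j a) \<in> sets lborel" for j a
      unfolding Q_def using emeasure_centered_box(2)[of "R2 j a"] R2 by (simp add: borel_closed)
    have U2: "(\<Union>a\<in>A j. Q (R2 j a)) \<in> sets lborel" for j using finA Qm2 by blast
    have e1: "emeasure lborel (\<Union>j. Q (R1 j)) \<le> ennreal (d * (2 ^ (2 * d - 1) * (1/2) ^ \<nu>))"
    proof -
      have "emeasure lborel (\<Union>j. Q (R1 j)) \<le> (\<Sum>j\<in>UNIV. emeasure lborel (Q (R1 j)))"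
        using Qm1 by (intro emeasure_subadditive_finite) auto
      also have "\<dots> = ennreal (d * (2 ^ (2 * d - 1) * (1/2) ^ \<nu>))"
        by (simp add: emQ1 d_def ennreal_of_nat_eq_real_of_nat ennreal_mult)
      finally show ?thesis .
    qed
    have e2: "emeasure lborel (\<Union>j. \<Union>a\<in>A j. Q (R2 j a))
        \<le> ennreal (d * (real (((d + 2) * \<nu>) ^ (d - 2)) * (2 ^ (2 * d - 1) * W)))"
    proof -
      have "emeasure lborel (\<Union>j. \<Union>a\<in>A j. Q (R2 j a)) \<le> (\<Sum>j\<in>UNIV. emeasure lborel (\<Union>a\<in>A j. Q (R2 j a)))"
        using U2 by (intro emeasure_subadditive_finite) auto
      also have "\<dots> \<le> (\<Sum>j\<in>(UNIV::'n set). ennreal (real (((d + 2) * \<nu>) ^ (d - 2)) * (2 ^ (2 * d - 1) * W)))"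
      proof (intro sum_mono)
        fix j
        have "emeasure lborel (\<Union>a\<in>A j. Q (R2 j a)) \<le> (\<Sum>a\<in>A j. emeasure lborel (Q (R2 j a)))"
          using Qm2 finA by (intro emeasure_subadditive_finite) auto
        also have "\<dots> = ennreal (real (card (A j)) * (2 ^ (2 * d - 1) * W))"
          using W by (simp add: emQ2 ennreal_of_nat_eq_real_of_nat ennreal_mult)
        also have "\<dots> \<le> ennreal (real (((d + 2) * \<nu>) ^ (d - 2)) * (2 ^ (2 * d - 1) * W))"
          using cardA[of j] W by (intro ennreal_leI mult_right_mono of_nat_mono) auto
        finally show "emeasure lborel (\<Union>a\<in>A j. Q (R2 j a))
            \<le> ennreal (real (((d + 2) * \<nu>) ^ (d - 2)) * (2 ^ (2 * d - 1) * W))" .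
      qed
      also have "\<dots> = ennreal (d * (real (((d + 2) * \<nu>) ^ (d - 2)) * (2 ^ (2 * d - 1) * W)))"
        using W by (simp add: d_def ennreal_of_nat_eq_real_of_nat ennreal_mult)
      finally show ?thesis .
    qed
    have "emeasure lborel ?S \<le> emeasure lborel ((\<Union>j. Q (R1 j)) \<union> (\<Union>j. \<Union>a\<in>A j. Q (R2 j a)))"
      using Qm1 U2 by (intro emeasure_mono sub) (auto intro!: sets.Un sets.finite_UN)
    also have "\<dots> \<le> emeasure lborel (\<Union>j. Q (R1 j)) + emeasure lborel (\<Union>j. \<Union>a\<in>A j. Q (R2 j a))"
      using Qm1 U2 by (intro emeasure_subadditive) (auto intro!: sets.finite_UN)
    also have "\<dots> \<le> ennreal (d * (2 ^ (2 * d - 1) * (1/2) ^ \<nu>))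
        + ennreal (d * (real (((d + 2) * \<nu>) ^ (d - 2)) * (2 ^ (2 * d - 1) * W)))"
      by (intro add_mono e1 e2)
    also have "\<dots> = ennreal (d * (2 ^ (2 * d - 1) * (1/2) ^ \<nu>)
        + d * (real (((d + 2) * \<nu>) ^ (d - 2)) * (2 ^ (2 * d - 1) * W)))"
      using W by (subst ennreal_plus) auto
    also have "\<dots> \<le> ennreal (C * (real \<nu> ^ (CARD('n) - 2) * W + (1/2) ^ \<nu>))"
    proof (intro ennreal_leI)
      have "(1::real) \<le> real (d + 2) ^ (d - 2)" by (intro one_le_power) simp
      then have "real d * 2 ^ (2 * d - 1) * (1/2) ^ \<nu> * 1 \<le> real d * 2 ^ (2 * d - 1) * (1/2) ^ \<nu> * real (d + 2) ^ (d - 2)"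
        by (intro mult_left_mono) auto
      then show "d * (2 ^ (2 * d - 1) * (1/2) ^ \<nu>)
        + d * (real (((d + 2) * \<nu>) ^ (d - 2)) * (2 ^ (2 * d - 1) * W))
        \<le> C * (real \<nu> ^ (CARD('n) - 2) * W + (1/2) ^ \<nu>)"
        unfolding C_def d_def[symmetric] of_nat_power of_nat_mult power_mult_distrib
        by (simp add: algebra_simps)
    qed
    finally show "emeasure lborel ?S \<le> ennreal (C * (real \<nu> ^ (CARD('n) - 2) * W + (1/2) ^ \<nu>))" .
  qed
qed

subsection \<open>Extension by a random vector\<close>

lemma real_dyadic_shell:
  assumes "(x::real) \<ge> 1"
  obtains \<nu> :: nat where "2 ^ \<nu> \<le> x" "x < 2 ^ (\<nu> + 1)"
proof -
  define n where "n = (LEAST n. x < 2 ^ n)"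
  have ex: "\<exists>n. x < 2 ^ n" by (rule real_arch_pow) simp
  have n: "x < 2 ^ n" unfolding n_def using ex by (rule LeastI_ex)
  then obtain \<nu> where \<nu>: "n = Suc \<nu>" using assms by (cases n) auto
  have "\<not> x < 2 ^ \<nu>" using not_less_Least[of \<nu> "\<lambda>n. x < 2 ^ n"] \<nu> by (simp add: n_def)
  then show thesis using n \<nu> by (intro that[of \<nu>]) auto
qed

text \<open>Borel-Cantelli in quantitative form: the bad vectors for all shells beyond some
  \<open>k0\<close> have total measure below 1, while the cube around \<open>b0\<close> has measure
  at least 1, so some \<open>b\<close> in the cube avoids them all. The lower shells contain only
  finitely many points.\<close>

lemma exists_extension_sparse:
  fixes B :: "(real^'n) set" and w :: "real \<Rightarrow> real"
  assumes dim: "CARD('n) \<ge> 2"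
    and B: "finite B" "independent B" "card B < CARD('n)"
    and w_pos: "\<And>t. t \<ge> 1 \<Longrightarrow> w t > 0"
    and w_decreasing: "antimono_on {1..} w"
    and w_series: "summable (\<lambda>k. real (Suc k) ^ (CARD('n) - 1) * w (2 ^ Suc k))"
  shows "\<exists>b. b \<notin> span B \<and> finite {x \<in> zspan (insert b B) - zspan B. coord_prod x \<le> w (infnorm x)}"
proof -
  have "dim (span B) < dim (UNIV :: (real^'n) set)"
    using B by (simp add: dim_eq_card_independent)
  then obtain v where v: "v \<notin> span B" by (metis UNIV_eq_I less_irrefl)
  obtain a where a: "a \<bullet> v = 1" "\<And>l. l \<in> span B \<Longrightarrow> a \<bullet> l = 0"
    using orthogonal_functional[OF v] by blast
  define K where "K = (\<Sum>i\<in>UNIV. \<bar>a $ i\<bar>)"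
  have K0: "K \<ge> 0" by (simp add: K_def sum_nonneg)
  \<comment> \<open>Since \<open>a \<bullet> b0 = K + 1\<close> and \<open>a \<bullet> b\<close>
    varies by at most \<open>K\<close> from it, \<open>a \<bullet> b >= 1\<close> on the whole cube.
    This keeps \<open>b\<close> off \<open>span B\<close> and gives
    \<open>|m| <= |a \<bullet> x|\<close> for \<open>x = m b + l\<close>.\<close>
  define b0 where "b0 = (K + 1) *\<^sub>R v"
  have ab: "a \<bullet> b \<ge> 1" if "infnorm (b - b0) \<le> 1" for b
  proof -
    have "\<bar>a \<bullet> (b - b0)\<bar> \<le> K * infnorm (b - b0)" using inner_le_infnorm[of a] by (simp add: K_def)
    also have "\<dots> \<le> K * 1" using that K0 by (intro mult_left_mono)
    finally show ?thesis using a(1) by (simp add: b0_def inner_diff_right)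
  qed
  obtain C where C: "C \<ge> 0"
    "\<And>x n. n \<ge> 1 \<Longrightarrow> finite {l \<in> zspan B. infnorm (l - x) \<le> n}"
    "\<And>x n. n \<ge> 1 \<Longrightarrow> real (card {l \<in> zspan B. infnorm (l - x) \<le> n}) \<le> C * n ^ card B"
    using card_zspan_near[OF B(1,2)] by blast
  have C': "real (card {l \<in> zspan B. infnorm (l - x) \<le> n}) \<le> C * n ^ (CARD('n) - 1)" if "n \<ge> 1" for x n
  proof -
    have "n ^ card B \<le> n ^ (CARD('n) - 1)" using that B(3) by (intro power_increasing) auto
    then show ?thesis using C(3)[OF that, of x] mult_left_mono[OF _ C(1)] by fastforce
  qed
  obtain D where D: "D \<ge> 0" "\<And>\<nu> W. \<nu> \<ge> (1::nat) \<Longrightarrow> W \<ge> 0 \<Longrightarrow>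
    emeasure lborel {x :: real^'n. 2 ^ \<nu> \<le> infnorm x \<and> infnorm x < 2 ^ (\<nu> + 1) \<and> coord_prod x \<le> W}
      \<le> ennreal (D * (real \<nu> ^ (CARD('n) - 2) * W + (1/2) ^ \<nu>))"
    using emeasure_small_coord_prod_shell[OF dim] by blast
  \<comment> \<open>\<open>w\<close> is taken at the lower end of the shell, so by monotonicity
    \<open>S \<nu>\<close> contains every point of the shell with
    \<open>coord_prod x <= w (infnorm x)\<close>.\<close>
  define S where "S \<nu> = {x :: real^'n. 2 ^ \<nu> \<le> infnorm x \<and> infnorm x < 2 ^ (\<nu> + 1) \<and> coord_prod x \<le> w (2 ^ \<nu>)}"
    for \<nu> :: nat
  have S_meas: "S \<nu> \<in> sets borel" and S_bdd: "bounded (S \<nu>)" for \<nu>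
  proof -
    have "closed {x :: real^'n. 2 ^ \<nu> \<le> infnorm x}" "open {x :: real^'n. infnorm x < 2 ^ (\<nu> + 1)}"
      "closed {x :: real^'n. coord_prod x \<le> w (2 ^ \<nu>)}"
      by (intro closed_Collect_le open_Collect_less continuous_intros continuous_on_coord_prod)+
    moreover have "S \<nu> = {x. 2 ^ \<nu> \<le> infnorm x} \<inter> {x. infnorm x < 2 ^ (\<nu> + 1)} \<inter> {x. coord_prod x \<le> w (2 ^ \<nu>)}"
      by (auto simp: S_def)
    ultimately show "S \<nu> \<in> sets borel"
      by (simp add: borel_closed borel_open sets.Int)
    have "norm x \<le> sqrt DIM(real^'n) * 2 ^ (\<nu> + 1)" if "x \<in> S \<nu>" for x
    proof -
      have "norm x \<le> sqrt DIM(real^'n) * infnorm x" by (rule norm_le_infnorm)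
      also have "\<dots> \<le> sqrt DIM(real^'n) * 2 ^ (\<nu> + 1)"
        using that by (intro mult_left_mono) (auto simp: S_def)
      finally show ?thesis .
    qed
    then show "bounded (S \<nu>)" by (rule boundedI)
  qed
  \<comment> \<open>A point of shell \<open>\<nu>\<close> has \<open>|m| <= K 2^(\<nu>+1)\<close>;
    \<open>K + 1\<close> in place of \<open>K\<close> secures \<open>N \<nu> >= 1\<close>.\<close>
  define N where "N \<nu> = nat \<lceil>(K + 1) * 2 ^ (\<nu> + 1)\<rceil>" for \<nu> :: nat
  have N: "N \<nu> \<ge> 1" "K * 2 ^ (\<nu> + 1) \<le> N \<nu>" "real (N \<nu>) \<le> (K + 2) * 2 ^ (\<nu> + 1)" for \<nu>
  proof -
    have p: "(1::real) \<le> 2 ^ (\<nu> + 1)" by (rule one_le_power) simp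
    have "real (N \<nu>) = of_int \<lceil>(K + 1) * 2 ^ (\<nu> + 1)\<rceil>"
      using K0 by (simp add: N_def)
    then have *: "(K + 1) * 2 ^ (\<nu> + 1) \<le> N \<nu>" "N \<nu> < (K + 1) * 2 ^ (\<nu> + 1) + 1" by linarith+
    show "K * 2 ^ (\<nu> + 1) \<le> N \<nu>" "real (N \<nu>) \<le> (K + 2) * 2 ^ (\<nu> + 1)"
      using * p unfolding distrib_right by linarith+
    have "0 < (K + 1) * 2 ^ (\<nu> + 1)" using K0 by simp
    then have "0 < real (N \<nu>)" using * by linarith
    then show "N \<nu> \<ge> 1" by simp
  qed
  \<comment> \<open>The logarithm from summing \<open>C / m\<close> over \<open>m <= N \<nu>\<close>
    is linear in \<open>\<nu>\<close>; this factor raises the exponent \<open>d - 2\<close> of the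
    volume bound to the \<open>d - 1\<close> of the series.\<close>
  define E where "E = ln (K + 2) + 3"
  have E: "1 + ln (N \<nu>) \<le> E * \<nu>" if "\<nu> \<ge> 1" for \<nu>
  proof -
    have "ln (N \<nu>) \<le> ln ((K + 2) * 2 ^ (\<nu> + 1))" using N(1,3)[of \<nu>] K0 by (subst ln_le_cancel_iff) auto
    also have "\<dots> = ln (K + 2) + real (\<nu> + 1) * ln 2"
      using K0 by (subst ln_mult) (simp_all only: ln_realpow zero_less_numeral, simp_all?)
    also have "\<dots> \<le> ln (K + 2) + real (\<nu> + 1) * 1"
      using ln_2_less_1 by (intro add_left_mono mult_left_mono) auto
    finally have "1 + ln (N \<nu>) \<le> ln (K + 2) + \<nu> + 2" by simp
    also have "\<dots> \<le> ln (K + 2) * \<nu> + \<nu> + 2 * \<nu>"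
    proof -
      have "ln (K + 2) * 1 \<le> ln (K + 2) * real \<nu>" using that K0 by (intro mult_left_mono) auto
      moreover have "real \<nu> \<ge> 1" using that by simp
      ultimately show ?thesis by linarith
    qed
    finally show ?thesis by (simp add: E_def algebra_simps)
  qed
  have E0: "E \<ge> 0" using K0 by (simp add: E_def)
  define H where "H \<nu> m = {b. infnorm (b - b0) \<le> 1 \<and> (\<exists>l\<in>zspan B. l + real m *\<^sub>R b \<in> S \<nu>)}"
    for \<nu> m :: nat
  have H: "H \<nu> m \<in> sets lborel" "emeasure lborel (H \<nu> m) \<le> ennreal (C / m) * emeasure lborel (S \<nu>)"
    if "m \<ge> 1" for \<nu> m
    using emeasure_hit[OF C(2) C' S_meas S_bdd that C(1)] by (auto simp: H_def)
  define bad where "bad \<nu> = (\<Union>m\<in>{1..N \<nu>}. H \<nu> m)" for \<nu>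
  have bad_meas: "bad \<nu> \<in> sets lborel" for \<nu>
    unfolding bad_def using H(1) by (intro sets.finite_UN) auto
  define c where "c \<nu> = C * E * D * (real \<nu> ^ (CARD('n) - 1) * w (2 ^ \<nu>) + real \<nu> * (1/2) ^ \<nu>)" for \<nu> :: nat
  have w0: "w (2 ^ \<nu>) \<ge> 0" for \<nu> :: nat using w_pos[of "2 ^ \<nu>"] by simp
  have c0: "c \<nu> \<ge> 0" for \<nu> using C(1) D(1) E0 w0 by (simp add: c_def)
  have bad: "emeasure lborel (bad \<nu>) \<le> ennreal (c \<nu>)" if \<nu>: "\<nu> \<ge> 1" for \<nu>
  proof -
    let ?V = "real \<nu> ^ (CARD('n) - 2) * w (2 ^ \<nu>) + (1/2) ^ \<nu>"
    have V: "?V \<ge> 0" using w0 by simp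
    have s0: "(\<Sum>m=1..N \<nu>. C / m) \<ge> 0" using C(1) by (intro sum_nonneg) auto
    have "emeasure lborel (bad \<nu>) \<le> (\<Sum>m=1..N \<nu>. emeasure lborel (H \<nu> m))"
      unfolding bad_def using H(1) by (intro emeasure_subadditive_finite) auto
    also have "\<dots> \<le> (\<Sum>m=1..N \<nu>. ennreal (C / m) * emeasure lborel (S \<nu>))"
      using H(2) by (intro sum_mono) auto
    also have "\<dots> = ennreal (\<Sum>m=1..N \<nu>. C / m) * emeasure lborel (S \<nu>)"
      using C(1) by (simp add: sum_distrib_right[symmetric])
    also have "\<dots> \<le> ennreal (\<Sum>m=1..N \<nu>. C / m) * ennreal (D * ?V)"
      using D(2)[OF \<nu> w0] by (intro mult_left_mono) (auto simp: S_def)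
    also have "\<dots> = ennreal ((\<Sum>m=1..N \<nu>. C / m) * (D * ?V))"
      using s0 D(1) V by (subst ennreal_mult) auto
    also have "\<dots> \<le> ennreal (c \<nu>)"
    proof (intro ennreal_leI)
      have "(\<Sum>m=1..N \<nu>. C / m) = C * (\<Sum>m=1..N \<nu>. 1 / real m)"
        by (simp add: sum_distrib_left)
      also have "\<dots> \<le> C * (E * \<nu>)"
        using order_trans[OF sum_inverse_le_ln[OF N(1)] E[OF \<nu>]] by (rule mult_left_mono) (rule C(1))
      finally have "(\<Sum>m=1..N \<nu>. C / m) * (D * ?V) \<le> C * (E * \<nu>) * (D * ?V)"
        using D(1) V by (intro mult_right_mono) auto
      also have "\<dots> = C * E * D * ((real \<nu> * real \<nu> ^ (CARD('n) - 2)) * w (2 ^ \<nu>) + real \<nu> * (1/2) ^ \<nu>)"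
        by (simp add: algebra_simps)
      also have "real \<nu> * real \<nu> ^ (CARD('n) - 2) = real \<nu> ^ (CARD('n) - 1)"
      proof -
        have "Suc (CARD('n) - 2) = CARD('n) - 1" using dim by simp
        then show ?thesis by (metis power_Suc)
      qed
      finally show "(\<Sum>m=1..N \<nu>. C / m) * (D * ?V) \<le> c \<nu>" by (simp add: c_def)
    qed
    finally show ?thesis .
  qed
  have "summable (\<lambda>k. c (Suc k))"
  proof -
    have "summable (\<lambda>k. real (Suc k) * (1/2::real) ^ k)"
      using geometric_deriv_sums[of "1/2::real"] by (simp add: sums_iff)
    then have "summable (\<lambda>k. real (Suc k) * (1/2::real) ^ k * (1/2))"
      by (rule summable_mult2)
    then have "summable (\<lambda>k. real (Suc k) * (1/2::real) ^ Suc k)"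
      by (simp add: mult_ac)
    then show ?thesis
      unfolding c_def by (intro summable_mult summable_add w_series)
  qed
  then obtain k0 where k0: "norm (\<Sum>k. c (Suc (k + k0))) < 1" and sm: "summable (\<lambda>k. c (Suc (k + k0)))"
    using suminf_exist_split[of 1 "\<lambda>k. c (Suc k)"] summable_ignore_initial_segment[of "\<lambda>k. c (Suc k)"] by auto
  let ?U = "\<Union>k. bad (Suc (k + k0))"
  have "emeasure lborel ?U \<le> (\<Sum>k. emeasure lborel (bad (Suc (k + k0))))"
    using bad_meas by (intro emeasure_subadditive_countably) auto
  also have "\<dots> \<le> (\<Sum>k. ennreal (c (Suc (k + k0))))"
    using bad by (intro suminf_le) auto
  also have "\<dots> = ennreal (\<Sum>k. c (Suc (k + k0)))"
    using c0 sm by (intro suminf_ennreal2) auto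
  also have "\<dots> < 1"
    using k0 by (simp add: ennreal_less_one_iff)
  finally have U: "emeasure lborel ?U < 1" .
  have "(1::ennreal) \<le> emeasure lborel {b. infnorm (b - b0) \<le> 1}"
  proof -
    have m: "{x :: real^'n. \<forall>j. \<bar>x $ j\<bar> \<le> 1} \<in> sets borel"
      using emeasure_centered_box(2)[of "\<lambda>_. 1"] by (simp add: borel_closed)
    have "{b. infnorm (b - b0) \<le> 1} = {b. - b0 + 1 *\<^sub>R b \<in> {x. \<forall>j. \<bar>x $ j\<bar> \<le> 1}}"
      by (auto simp: infnorm_cart_le_iff)
    then have "emeasure lborel {b. infnorm (b - b0) \<le> 1} = emeasure lborel {x :: real^'n. \<forall>j. \<bar>x $ j\<bar> \<le> 1}"
      using emeasure_lborel_vimage_affine[OF _ m, of 1 "- b0"] by simp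
    also have "\<dots> = ennreal (2 ^ CARD('n))"
      using emeasure_centered_box(1)[of "\<lambda>_::'n. 1"] by simp
    also have "\<dots> \<ge> ennreal 1"
      by (intro ennreal_leI one_le_power) simp
    finally show ?thesis by simp
  qed
  then have "\<not> {b. infnorm (b - b0) \<le> 1} \<subseteq> ?U"
    using U emeasure_mono[of "{b. infnorm (b - b0) \<le> 1}" ?U lborel] bad_meas
    by (metis (no_types, lifting) leD order_trans sets.countable_UN image_subset_iff)
  then obtain b where b: "infnorm (b - b0) \<le> 1" "\<And>k. b \<notin> bad (Suc (k + k0))" by blast
  have b_span: "b \<notin> span B" using ab[OF b(1)] a(2)[of b] by auto
  then have bB: "b \<notin> B" by (meson span_base)
  have "independent (insert b B)" using B(2) b_span by (simp add: independent_insert bB)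
  then have "finite {x \<in> zspan (insert b B). infnorm x \<le> 2 ^ (k0 + 1)}"
    using B(1) by (intro finite_zspan_infnorm_le) auto
  moreover have "{x \<in> zspan (insert b B) - zspan B. coord_prod x \<le> w (infnorm x)}
      \<subseteq> {x \<in> zspan (insert b B). infnorm x \<le> 2 ^ (k0 + 1)}"
  proof
    fix x assume "x \<in> {x \<in> zspan (insert b B) - zspan B. coord_prod x \<le> w (infnorm x)}"
    then have x: "x \<in> zspan (insert b B)" "x \<notin> zspan B" "coord_prod x \<le> w (infnorm x)" by auto
    obtain m l where ml: "x = of_int m *\<^sub>R b + l" "l \<in> zspan B"
      using x(1) zspan_insert[OF B(1) bB] by auto
    have "m \<noteq> 0" using ml x(2) by auto
    show "x \<in> {x \<in> zspan (insert b B). infnorm x \<le> 2 ^ (k0 + 1)}"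
    proof (rule ccontr)
      assume "\<not> ?thesis"
      then have big: "infnorm x > 2 ^ (k0 + 1)" using x(1) by simp
      moreover have one: "(1::real) \<le> 2 ^ n" for n by (rule one_le_power) simp
      ultimately have "infnorm x \<ge> 1" by (smt (verit))
      then obtain \<nu> where \<nu>: "2 ^ \<nu> \<le> infnorm x" "infnorm x < 2 ^ (\<nu> + 1)"
        using real_dyadic_shell by blast
      then have "(2::real) ^ (k0 + 1) < 2 ^ (\<nu> + 1)" using big by linarith
      then have "k0 + 1 < \<nu> + 1" by (subst (asm) power_strict_increasing_iff) auto
      then have "\<nu> = Suc ((\<nu> - Suc k0) + k0)" by simp
      then have b_bad: "b \<notin> bad \<nu>" using b(2) by metis
      have "w (infnorm x) \<le> w (2 ^ \<nu>)"
        using \<nu>(1) \<open>infnorm x \<ge> 1\<close> one by (intro monotone_onD[OF w_decreasing]) auto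
      then have xS: "x \<in> S \<nu>" using \<nu> x(3) by (simp add: S_def)
      \<comment> \<open>\<open>H\<close> records positive multiples only; a point with negative
        \<open>m\<close> is replaced by its negative, since \<open>S \<nu>\<close> and
        \<open>zspan B\<close> are symmetric.\<close>
      then have mxS: "- x \<in> S \<nu>" by (simp add: S_def infnorm_neg coord_prod_def)
      have "a \<bullet> x = of_int m * (a \<bullet> b)"
        using ml a(2)[of l] zspan_subset_span[of B] by (auto simp: inner_add_right)
      then have "\<bar>a \<bullet> x\<bar> = \<bar>of_int m\<bar> * (a \<bullet> b)"
        using ab[OF b(1)] by (simp add: abs_mult)
      then have "\<bar>of_int m\<bar> \<le> \<bar>a \<bullet> x\<bar>"
        using ab[OF b(1)] mult_left_mono[of 1 "a \<bullet> b" "\<bar>of_int m\<bar>"] by simp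
      also have "\<dots> \<le> K * infnorm x" using inner_le_infnorm[of a x] by (simp add: K_def)
      also have "\<dots> \<le> K * 2 ^ (\<nu> + 1)" using \<nu>(2) K0 by (intro mult_left_mono) auto
      also have "\<dots> \<le> N \<nu>" by (rule N)
      finally have mN: "nat \<bar>m\<bar> \<in> {1..N \<nu>}" using \<open>m \<noteq> 0\<close> by auto
      have "b \<in> H \<nu> (nat \<bar>m\<bar>)"
      proof (cases "m > 0")
        case True
        then have "l + real (nat \<bar>m\<bar>) *\<^sub>R b = x" by (simp add: ml(1))
        then show ?thesis using b(1) ml(2) xS by (auto simp: H_def)
      next
        case False
        then have "- l + real (nat \<bar>m\<bar>) *\<^sub>R b = - x" by (simp add: ml(1))
        then show ?thesis using b(1) zspan_uminus[OF ml(2)] mxS unfolding H_def by (metis (mono_tags, lifting) mem_Collect_eq)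
      qed
      then have "b \<in> bad \<nu>" using mN unfolding bad_def by blast
      then show False using b_bad by blast
    qed
  qed
  ultimately have "finite {x \<in> zspan (insert b B) - zspan B. coord_prod x \<le> w (infnorm x)}"
    by (rule rev_finite_subset)
  then show ?thesis using b_span by blast
qed

text \<open>Induction on the missing rank: the points outside \<open>zspan B\<close> with small
  product enter either with the first adjoined vector or later, and both sets are finite.\<close>

lemma exists_basis_sparse:
  fixes B :: "(real^'n) set" and w :: "real \<Rightarrow> real"
  assumes dim: "CARD('n) \<ge> 2"
    and B: "finite B" "independent B"
    and w_pos: "\<And>t. t \<ge> 1 \<Longrightarrow> w t > 0"
    and w_decreasing: "antimono_on {1..} w"
    and w_series: "summable (\<lambda>k. real (Suc k) ^ (CARD('n) - 1) * w (2 ^ Suc k))"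
  shows "\<exists>B'. finite B' \<and> independent B' \<and> card B' = CARD('n) \<and> zspan B \<subseteq> zspan B' \<and>
    finite {x \<in> zspan B' - zspan B. coord_prod x \<le> w (infnorm x)}"
  using B
proof (induction "CARD('n) - card B" arbitrary: B rule: less_induct)
  case less
  have le: "card B \<le> CARD('n)"
    using independent_bound[OF less.prems(2)] by simp
  show ?case
  proof (cases "card B = CARD('n)")
    case True
    then show ?thesis using less.prems by (intro exI[of _ B]) auto
  next
    case False
    then have lt: "card B < CARD('n)" using le by simp
    obtain b where b: "b \<notin> span B"
      "finite {x \<in> zspan (insert b B) - zspan B. coord_prod x \<le> w (infnorm x)}"
      using exists_extension_sparse[OF dim less.prems lt w_pos w_decreasing w_series] by blast
    have bB: "b \<notin> B" using b(1) by (meson span_base)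
    have "\<exists>B'. finite B' \<and> independent B' \<and> card B' = CARD('n) \<and>
        zspan (insert b B) \<subseteq> zspan B' \<and>
        finite {x \<in> zspan B' - zspan (insert b B). coord_prod x \<le> w (infnorm x)}"
      using less.prems b(1) bB lt
      by (intro less.hyps) (auto simp: independent_insert)
    then obtain B' where B': "finite B'" "independent B'" "card B' = CARD('n)"
        "zspan (insert b B) \<subseteq> zspan B'"
        "finite {x \<in> zspan B' - zspan (insert b B). coord_prod x \<le> w (infnorm x)}"
      by blast
    have "zspan B \<subseteq> zspan (insert b B)"
    proof
      fix l assume "l \<in> zspan B"
      then show "l \<in> zspan (insert b B)"
        unfolding zspan_insert[OF less.prems(1) bB] by (intro CollectI exI[of _ 0] exI[of _ l]) simp
    qed
    moreover have "{x \<in> zspan B' - zspan B. coord_prod x \<le> w (infnorm x)} \<subseteq>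
        {x \<in> zspan B' - zspan (insert b B). coord_prod x \<le> w (infnorm x)} \<union>
        {x \<in> zspan (insert b B) - zspan B. coord_prod x \<le> w (infnorm x)}" by blast
    ultimately show ?thesis
      using B' b(2) by (intro exI[of _ B']) (auto intro: finite_subset)
  qed
qed

lemma is_lattice_zspan:
  fixes B :: "(real^'n) set"
  assumes "finite B" "independent B" "card B = CARD('n)"
  shows "is_lattice (zspan B)"
proof -
  obtain f :: "'n \<Rightarrow> real^'n" where f: "bij_betw f UNIV B"
    using finite_same_card_bij[of "UNIV :: 'n set" B] assms by auto
  have inj: "inj f" and range: "range f = B" using f by (auto simp: bij_betw_def)
  have "zspan B = {\<Sum>i\<in>UNIV. of_int (c i) *\<^sub>R f i | c :: 'n \<Rightarrow> int. True}"
  proof (intro equalityI subsetI)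
    fix x assume "x \<in> zspan B"
    then obtain c where "x = (\<Sum>v\<in>B. of_int (c v) *\<^sub>R v)" by (auto simp: zspan_def)
    also have "\<dots> = (\<Sum>i\<in>UNIV. of_int (c (f i)) *\<^sub>R f i)"
      using sum.reindex_bij_betw[OF f, of "\<lambda>v. of_int (c v) *\<^sub>R v"] by simp
    finally show "x \<in> {\<Sum>i\<in>UNIV. of_int (c i) *\<^sub>R f i | c :: 'n \<Rightarrow> int. True}"
      by (intro CollectI exI[of _ "\<lambda>i. c (f i)"]) simp
  next
    fix x assume "x \<in> {\<Sum>i\<in>UNIV. of_int (c i) *\<^sub>R f i | c :: 'n \<Rightarrow> int. True}"
    then obtain c :: "'n \<Rightarrow> int" where "x = (\<Sum>i\<in>UNIV. of_int (c i) *\<^sub>R f i)" by blast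
    also have "\<dots> = (\<Sum>v\<in>B. of_int (c (inv f v)) *\<^sub>R v)"
      using sum.reindex_bij_betw[OF f, of "\<lambda>v. of_int (c (inv f v)) *\<^sub>R v"] inj by simp
    finally show "x \<in> zspan B"
      unfolding zspan_def by (intro CollectI exI[of _ "\<lambda>v. c (inv f v)"]) simp
  qed
  then show ?thesis
    unfolding is_lattice_def using inj range assms(2) by blast
qed

subsection \<open>The plane of exceptional points\<close>

text \<open>
  With \<open>q\<^bsub>k+1\<^esub> = a\<^sub>k q\<^sub>k - q\<^bsub>k-1\<^esub>\<close> the fractions \<open>p\<^sub>k / q\<^sub>k\<close> increase and
  \<open>(p\<^bsub>k+1\<^esub> - p\<^sub>k) / (q\<^bsub>k+1\<^esub> - q\<^sub>k)\<close> decrease, which locates their limit \<open>\<theta>\<close>.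
\<close>
lemma exists_prescribed_approximations:
  fixes A :: "int \<Rightarrow> int" and Q :: int
  assumes A: "\<And>q. q \<ge> Q \<Longrightarrow> A q \<ge> 3" and Q: "Q \<ge> 2"
  obtains \<theta> :: real and p q :: "nat \<Rightarrow> int" and c :: real where
    "\<theta> \<ge> 0" "c > 0" "\<And>k. q k \<ge> Q" "\<And>k. q k \<ge> int k"
    "\<And>k. (A (q k) - 1) * q k \<le> q (Suc k)" "\<And>k. q (Suc k) \<le> A (q k) * q k"
    "\<And>k. 1 / q (Suc k) \<le> \<theta> * q k - p k" "\<And>k. \<theta> * q k - p k \<le> 1 / (q (Suc k) - q k)"
    "\<And>(x::int) (y::int) (N::real). N \<ge> 1 \<Longrightarrow> N \<ge> \<bar>x\<bar> \<Longrightarrow>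
       (\<exists>k m. x = m * q k \<and> y = m * p k) \<or> c \<le> \<bar>\<theta> * x - y\<bar> * N"
proof -
  \<comment> \<open>The state is a pair of consecutive fractions, the older first, starting with
    \<open>0/1\<close> and \<open>1/Q\<close>. Their determinant \<open>p q' - p' q = 1\<close> is
    preserved by the recursion.\<close>
  define st :: "nat \<Rightarrow> int \<times> int \<times> int \<times> int" where
    "st = rec_nat (1, 0, Q, 1) (\<lambda>_ (q', p', q, p). (q, p, A q * q - q', A q * p - p'))"
  define q where "q k = fst (snd (snd (st k)))" for k
  define p where "p k = snd (snd (snd (st k)))" for k
  define q' where "q' k = fst (st k)" for k
  define p' where "p' k = fst (snd (st k))" for k
  have init: "q 0 = Q" "p 0 = 1" "q' 0 = 1" "p' 0 = 0"
    by (simp_all add: q_def p_def q'_def p'_def st_def)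
  have step: "q (Suc k) = A (q k) * q k - q' k" "p (Suc k) = A (q k) * p k - p' k"
    "q' (Suc k) = q k" "p' (Suc k) = p k" for k
    by (simp_all add: q_def p_def q'_def p'_def st_def split: prod.splits)
  have inv: "q' k \<ge> 1 \<and> q k \<ge> 2 * q' k \<and> q k \<ge> Q \<and> q k \<ge> int k \<and> p k * q' k - p' k * q k = 1" for k
  proof (induction k)
    case 0
    then show ?case using Q by (simp add: init)
  next
    case (Suc k)
    then have "A (q k) * q k \<ge> 3 * q k" using A[of "q k"] Q by (intro mult_right_mono) auto
    then have "q (Suc k) \<ge> 2 * q k" using Suc Q unfolding step by linarith
    moreover have "p (Suc k) * q' (Suc k) - p' (Suc k) * q (Suc k) = p k * q' k - p' k * q k"
      by (simp add: step algebra_simps)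
    moreover have "int (Suc k) \<le> 2 * q k" using Suc Q by simp
    ultimately show ?case using Suc Q by (simp add: step(3))
  qed
  have qpos: "q k \<ge> 2" and q'pos: "q' k \<ge> 1" and dbl: "2 * q k \<le> q (Suc k)"
    and det: "p k * q' k - p' k * q k = 1" for k
    using inv[of k] inv[of "Suc k"] Q by (auto simp: step)
  have det': "p (Suc k) * q k - p k * q (Suc k) = 1" for k using det[of "Suc k"] by (simp add: step)
  define u where "u k = p k / q k" for k
  define v where "v k = (p (Suc k) - p k) / (q (Suc k) - q k)" for k
  have rdet: "real_of_int (p (Suc k)) * q k - p k * q (Suc k) = 1" for k
    
    using arg_cong[OF det'[of k], of real_of_int] by (simp only: of_int_1 of_int_diff of_int_mult)
  have rq: "real_of_int (q k) > 0" "real_of_int (q (Suc k)) - q k > 0" "2 * real_of_int (q k) \<le> q (Suc k)" for k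
    using qpos[of k] dbl[of k] by linarith+
  have frac: "a / d = c / b + 1 / (b * d)" if "a * b - c * d = 1" "b > 0" "d > 0" for a b c d :: real
  proof -
    have "c / b + 1 / (b * d) = (c * d + 1) / (b * d)" using that(2,3) by (simp add: add_divide_distrib)
    also have "c * d + 1 = a * b" using that(1) by simp
    finally show ?thesis using that(2,3) by simp
  qed
  have u_step: "u (Suc k) = u k + 1 / (q k * q (Suc k))" for k
    unfolding u_def of_int_mult using rdet[of k] by (intro frac rq) simp
  have v_u: "v k = u k + 1 / (q k * (q (Suc k) - q k))" for k
    unfolding u_def v_def of_int_mult of_int_diff
    using rdet[of k] by (intro frac rq) (simp add: algebra_simps)
  have v_u': "v k = u (Suc k) + 1 / (q (Suc k) * (q (Suc k) - q k))" for k
    unfolding u_def v_def of_int_mult of_int_diff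
    using rdet[of k] by (intro frac rq) (simp add: algebra_simps)
  have u_mono: "mono u"
    using rq(1) by (intro mono_iff_le_Suc[THEN iffD2] allI) (simp add: u_step less_imp_le)
  have v_anti: "antimono v"
  proof (intro antimono_iff_le_Suc[THEN iffD2] allI)
    fix k
    have "real_of_int (q (Suc k)) * (q (Suc k) - q k) \<le> q (Suc k) * (q (Suc (Suc k)) - q (Suc k))"
      using rq(1)[of "Suc k"] rq(3)[of "Suc k"] rq(1)[of k]
      unfolding of_int_mult of_int_diff by (intro mult_left_mono) auto
    then have "1 / (real_of_int (q (Suc k)) * (q (Suc (Suc k)) - q (Suc k))) \<le> 1 / (q (Suc k) * (q (Suc k) - q k))"
      using rq(1)[of "Suc k"] rq(2)[of k] rq(2)[of "Suc k"] by (intro divide_left_mono) auto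
    then show "v (Suc k) \<le> v k" using v_u[of "Suc k"] v_u'[of k] by simp
  qed
  have uv: "u j \<le> v k" for j k
  proof -
    have "u j \<le> u (max j k)" using u_mono by (simp add: monoD)
    also have "\<dots> \<le> v (max j k)"
      using v_u[of "max j k"] rq(1,2)[of "max j k"] by (simp add: less_imp_le)
    also have "\<dots> \<le> v k" using v_anti by (simp add: antimonoD)
    finally show ?thesis .
  qed
  \<comment> \<open>\<open>\<theta>\<close> lies between \<open>u (Suc k)\<close> and
    \<open>v k\<close> for every \<open>k\<close>; the left end yields the lower bound for
    \<open>\<theta> q k - p k\<close>, the right end the upper bound.\<close>
  define \<theta> where "\<theta> = (SUP k. u k)"
  have bdd: "bdd_above (range u)" using uv by (auto intro!: bdd_aboveI[of _ "v 0"])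
  have u\<theta>: "u k \<le> \<theta>" for k unfolding \<theta>_def using bdd by (intro cSUP_upper) auto
  have \<theta>v: "\<theta> \<le> v k" for k unfolding \<theta>_def using uv by (intro cSUP_least) auto
  have \<theta>_u: "(\<theta> - u k) * q k = \<theta> * q k - p k" for k
    using rq(1)[of k] by (simp add: u_def left_diff_distrib)
  have low: "1 / q (Suc k) \<le> \<theta> * q k - p k" for k
  proof -
    have "1 / q (Suc k) = (u (Suc k) - u k) * q k" using rq(1)[of k] by (simp add: u_step)
    also have "\<dots> \<le> (\<theta> - u k) * q k" using u\<theta>[of "Suc k"] rq(1)[of k] by (intro mult_right_mono) auto
    finally show ?thesis unfolding \<theta>_u .
  qed
  have upp: "\<theta> * q k - p k \<le> 1 / (q (Suc k) - q k)" for k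
  proof -
    have "(\<theta> - u k) * q k \<le> (v k - u k) * q k" using \<theta>v[of k] rq(1)[of k] by (intro mult_right_mono) auto
    also have "\<dots> = 1 / (q (Suc k) - q k)" using rq(1)[of k] by (simp add: v_u)
    finally show ?thesis unfolding \<theta>_u .
  qed
  \<comment> \<open>\<open>1 / (2 Q)\<close> serves the case \<open>k = 0\<close> below,
    \<open>1/8\<close> all larger \<open>k\<close>.\<close>
  define c where "c = min (1/8) (1 / (2 * real_of_int Q))"
  have "c > 0" using Q by (simp add: c_def)
  have main: "(\<exists>k m. x = m * q k \<and> y = m * p k) \<or> c \<le> \<bar>\<theta> * x - y\<bar> * N"
    if N: "N \<ge> 1" "N \<ge> \<bar>x\<bar>" for x y :: int and N :: real
  proof -
    \<comment> \<open>The least such \<open>k\<close> is the scale fitting \<open>x\<close>: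
      \<open>P k\<close> makes \<open>|x| \<delta>\<close> at most 1/2, and the failure of
      \<open>P (k - 1)\<close> gives \<open>q k < 4 |x|\<close>.\<close>
    define P where "P k \<longleftrightarrow> 2 * \<bar>x\<bar> \<le> q (Suc k) - q k" for k
    have ex: "P (nat (2 * \<bar>x\<bar>))"
      using inv[of "nat (2 * \<bar>x\<bar>)"] dbl[of "nat (2 * \<bar>x\<bar>)"] unfolding P_def by simp
    define k where "k = (LEAST k. P k)"
    have k: "P k" unfolding k_def using ex by (rule LeastI)
    show ?thesis
    proof (cases "x * p k = y * q k")
      case True
      \<comment> \<open>By the determinant 1, \<open>m\<close> is the coordinate of
        \<open>(x, y)\<close> along \<open>(q k, p k)\<close> in the integer basis completed by
        \<open>(q' k, p' k)\<close>; the other coordinate is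
        \<open>x p k - y q k = 0\<close>.\<close>
      define m where "m = y * q' k - x * p' k"
      have "x = x * (p k * q' k - p' k * q k)" using det by simp
      also have "\<dots> = (x * p k) * q' k - x * p' k * q k" by (simp add: algebra_simps)
      also have "\<dots> = m * q k" unfolding True m_def by (simp add: algebra_simps)
      finally have "x = m * q k" .
      moreover have "y = y * (p k * q' k - p' k * q k)" using det by simp
      then have "y = y * q' k * p k - (y * q k) * p' k" by (simp add: algebra_simps)
      then have "y = m * p k" unfolding True[symmetric] m_def by (simp add: algebra_simps)
      ultimately have "x = m * q k" "y = m * p k" by blast+
      then show ?thesis by blast
    next
      case False
      define \<delta> where "\<delta> = \<theta> * q k - p k"
      have \<delta>: "0 \<le> \<delta>" "\<delta> \<le> 1 / (q (Suc k) - q k)"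
      proof -
        have "0 \<le> 1 / real_of_int (q (Suc k))" using rq(1)[of "Suc k"] by simp
        then show "0 \<le> \<delta>" using low[of k] unfolding \<delta>_def by linarith
        show "\<delta> \<le> 1 / (q (Suc k) - q k)" unfolding \<delta>_def by (rule upp)
      qed
      have "1 \<le> \<bar>x * p k - y * q k\<bar>" using False by linarith
      then have "real_of_int 1 \<le> real_of_int \<bar>x * p k - y * q k\<bar>" by (simp only: of_int_le_iff)
      then have one: "1 \<le> \<bar>real_of_int x * p k - y * q k\<bar>"
        by (simp only: of_int_1 of_int_abs of_int_diff of_int_mult)
      have "real_of_int (2 * \<bar>x\<bar>) \<le> real_of_int (q (Suc k) - q k)" using k unfolding P_def by (simp only: of_int_le_iff)
      then have x2: "2 * \<bar>real_of_int x\<bar> \<le> real_of_int (q (Suc k)) - q k" by simp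
      have "\<bar>real_of_int x\<bar> * \<delta> \<le> \<bar>real_of_int x\<bar> * (1 / (q (Suc k) - q k))"
        using \<delta> by (intro mult_left_mono) auto
      also have "\<dots> \<le> 1/2" using x2 rq(2)[of k] by (simp add: field_simps)
      finally have half: "\<bar>x * \<delta>\<bar> \<le> 1/2" using \<delta>(1) by (simp add: abs_mult)
      \<comment> \<open>A nonzero integer plus a term of size at most 1/2.\<close>
      have "q k * (\<theta> * x - y) = x * \<delta> + (x * p k - y * q k)"
        by (simp add: \<delta>_def algebra_simps)
      then have "\<bar>q k * (\<theta> * x - y)\<bar> \<ge> 1/2" using half one unfolding of_int_mult of_int_diff by linarith
      then have "\<bar>\<theta> * x - y\<bar> * q k \<ge> 1/2" using rq(1)[of k] by (simp add: abs_mult mult.commute)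
      then have lower: "1 / (2 * q k) \<le> \<bar>\<theta> * x - y\<bar>" using rq(1)[of k] by (simp add: field_simps)
      have "c \<le> 1 / (2 * q k) * N"
      proof (cases k)
        case 0
        have "c \<le> 1 / (2 * Q)" by (simp add: c_def)
        also have "\<dots> \<le> 1 / (2 * Q) * N" using N(1) Q mult_left_mono[of 1 N "1 / (2 * real_of_int Q)"] by simp
        finally show ?thesis by (simp add: 0 init)
      next
        case (Suc j)
        have "\<not> P j" using not_less_Least[of j P] Suc by (simp add: k_def)
        then have "q k - q j < 2 * \<bar>x\<bar>" by (simp add: P_def Suc)
        then have "q k < 4 * \<bar>x\<bar>" using dbl[of j] Suc by simp
        then have "real_of_int (q k) < real_of_int (4 * \<bar>x\<bar>)" by (simp only: of_int_less_iff)
        then have "q k \<le> 4 * N" using N(2) by simp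
        then have "1/8 \<le> 1 / (2 * q k) * N" using rq(1)[of k] by (simp add: field_simps)
        then show ?thesis by (simp add: c_def)
      qed
      also have "\<dots> \<le> \<bar>\<theta> * x - y\<bar> * N" using lower N(1) by (intro mult_right_mono) auto
      finally show ?thesis by blast
    qed
  qed
  have "A (q k) * q k - q k \<le> q (Suc k)" "q (Suc k) \<le> A (q k) * q k" for k
    using q'pos[of k] inv[of k] by (auto simp: step(1))
  moreover have "\<theta> \<ge> 0" using u\<theta>[of 0] Q by (simp add: u_def init) (smt (verit) of_int_0_le_iff divide_nonneg_nonneg)
  ultimately show thesis
    using that[of \<theta> c q p] \<open>c > 0\<close> inv low upp main by (auto simp: algebra_simps)
qed

section \<open>Badly approximable forms from the irrationality of \<open>sqrt 2\<close>\<close>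

lemma two_mult_square_neq_square:
  fixes x m :: int
  assumes "2 * x\<^sup>2 = m\<^sup>2"
  shows "x = 0 \<and> m = 0"
  using assms
proof (induction "nat \<bar>x\<bar> + nat \<bar>m\<bar>" arbitrary: x m rule: less_induct)
  case less
  have "even (m\<^sup>2)" using less.prems by (metis dvd_triv_left)
  then obtain m' where m': "m = 2 * m'" by (auto elim: evenE)
  then have x: "2 * m'\<^sup>2 = x\<^sup>2" using less.prems by (simp add: power_mult_distrib)
  show ?case
  proof (cases "m = 0")
    case True
    then show ?thesis using less.prems by simp
  next
    case False
    then have "m' = 0 \<and> x = 0" using m' x by (intro less.hyps) auto
    then show ?thesis using m' by simp
  qed
qed

text \<open>With \<open>m = f x + y\<close> the form is \<open>sqrt 2 x + m\<close>. Its product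
  with the conjugate \<open>sqrt 2 x - m\<close> is the nonzero integer \<open>2 x^2 - m^2\<close>,
  and the conjugate is at most \<open>(sqrt 2 + f + 1) N\<close> in absolute value.\<close>

lemma sqrt2_form_lower_bound:
  fixes x y f :: int and N :: real
  assumes "f \<ge> 0" "N \<ge> \<bar>x\<bar>" "N \<ge> \<bar>y\<bar>" "x \<noteq> 0 \<or> y \<noteq> 0"
  shows "1 \<le> \<bar>(sqrt 2 + f) * x + y\<bar> * ((sqrt 2 + f + 1) * N)"
proof -
  define m where "m = f * x + y"
  have "2 * x\<^sup>2 \<noteq> m\<^sup>2"
    using two_mult_square_neq_square[of x m] assms(4) by (auto simp: m_def)
  then have "1 \<le> \<bar>2 * x\<^sup>2 - m\<^sup>2\<bar>" by linarith
  then have "real_of_int 1 \<le> real_of_int \<bar>2 * x\<^sup>2 - m\<^sup>2\<bar>" by (simp only: of_int_le_iff)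
  then have "1 \<le> \<bar>2 * (real_of_int x)\<^sup>2 - (real_of_int m)\<^sup>2\<bar>"
    by (simp only: of_int_1 of_int_abs of_int_diff of_int_mult of_int_numeral of_int_power)
  also have "2 * (real_of_int x)\<^sup>2 - (real_of_int m)\<^sup>2 = (sqrt 2 * x + m) * (sqrt 2 * x - m)"
    by (simp add: algebra_simps power2_eq_square)
  also have "sqrt 2 * x + m = (sqrt 2 + f) * x + y" by (simp add: m_def algebra_simps)
  also have "\<bar>((sqrt 2 + f) * x + y) * (sqrt 2 * x - m)\<bar> \<le> \<bar>(sqrt 2 + f) * x + y\<bar> * ((sqrt 2 + f + 1) * N)"
    unfolding abs_mult
  proof (intro mult_left_mono)
    have "\<bar>sqrt 2 * x - m\<bar> \<le> sqrt 2 * \<bar>real_of_int x\<bar> + f * \<bar>real_of_int x\<bar> + \<bar>real_of_int y\<bar>"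
      using assms(1) abs_triangle_ineq4[of "sqrt 2 * x" "f * x + y"] abs_triangle_ineq[of "real_of_int (f * x)" y]
      by (simp add: m_def abs_mult)
    also have "\<dots> \<le> sqrt 2 * N + f * N + N"
      using assms by (intro add_mono mult_left_mono) auto
    finally show "\<bar>sqrt 2 * x - m\<bar> \<le> (sqrt 2 + f + 1) * N" by (simp add: algebra_simps)
  qed simp
  finally show ?thesis .
qed

text \<open>A single \<open>\<delta> > 0\<close> suffices: for large \<open>t\<close> one has
  \<open>t <= (1 + \<delta>) (t - 1)\<close>, and monotonicity turns the ratio condition at
  \<open>t - 1\<close> into the first bound. The second holds in the limit because
  \<open>(1 - \<epsilon>) (1 + \<epsilon>) < 1\<close>; it absorbs the loss \<open>1 + 4 w t\<close>
  from rounding the multipliers \<open>A\<close> and the loss \<open>(1 - 1/t)^n\<close> from the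
  large coordinates of the special points.\<close>

lemma eventually_ratio_bounds:
  fixes w :: "real \<Rightarrow> real" and \<epsilon> :: real
  assumes w_pos: "\<And>t. t \<ge> 1 \<Longrightarrow> w t > 0"
    and w_decreasing: "antimono_on {1..} w"
    and w_tendsto_zero: "(w \<longlongrightarrow> 0) at_top"
    and w_ratio: "((\<lambda>\<delta>. SUP t\<in>{1..}. ereal (w t / w ((1 + \<delta>) * t))) \<longlongrightarrow> 1) (at 0)"
    and eps: "0 < \<epsilon>" "\<epsilon> < 1"
  shows "\<exists>T\<ge>3. \<forall>t\<ge>T. w (t - 1) \<le> (1 + \<epsilon>) * w t \<and> (1 - \<epsilon>) * (1 + \<epsilon>) * (1 + 4 * w t) < (1 - 1 / t) ^ n"
proof -
  have "eventually (\<lambda>\<delta>. (SUP t\<in>{1..}. ereal (w t / w ((1 + \<delta>) * t))) < ereal (1 + \<epsilon>)) (at 0)"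
    using w_ratio eps by (intro order_tendstoD(2)) auto
  then obtain r where r: "r > 0" "\<And>\<delta>. \<delta> \<noteq> 0 \<Longrightarrow> dist \<delta> 0 < r \<Longrightarrow>
      (SUP t\<in>{1..}. ereal (w t / w ((1 + \<delta>) * t))) < ereal (1 + \<epsilon>)"
    unfolding eventually_at by blast
  define \<delta> where "\<delta> = r / 2"
  have \<delta>: "\<delta> > 0" using r(1) by (simp add: \<delta>_def)
  have sup: "(SUP t\<in>{1..}. ereal (w t / w ((1 + \<delta>) * t))) < ereal (1 + \<epsilon>)"
    using r(1) by (intro r(2)) (auto simp: \<delta>_def)
  have step: "w (t - 1) \<le> (1 + \<epsilon>) * w t" if t: "t \<ge> max 3 (1 + 1 / \<delta>)" for t
  proof -
    have t1: "t - 1 \<ge> 1" using t by simp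
    have "ereal (w (t - 1) / w ((1 + \<delta>) * (t - 1))) \<le> (SUP t\<in>{1..}. ereal (w t / w ((1 + \<delta>) * t)))"
      using t1 by (intro SUP_upper) auto
    then have "ereal (w (t - 1) / w ((1 + \<delta>) * (t - 1))) < ereal (1 + \<epsilon>)"
      using sup by (rule le_less_trans)
    then have lt: "w (t - 1) / w ((1 + \<delta>) * (t - 1)) < 1 + \<epsilon>" by simp
    have "\<delta> * (1 / \<delta>) \<le> \<delta> * (t - 1)" using t \<delta> by (intro mult_left_mono) auto
    then have ge: "t \<le> (1 + \<delta>) * (t - 1)" using \<delta> by (simp add: algebra_simps)
    have "w ((1 + \<delta>) * (t - 1)) > 0" using ge t1 by (intro w_pos) linarith
    then have "w (t - 1) \<le> (1 + \<epsilon>) * w ((1 + \<delta>) * (t - 1))" using lt by (simp add: field_simps)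
    also have "\<dots> \<le> (1 + \<epsilon>) * w t"
      using ge t1 eps by (intro mult_left_mono monotone_onD[OF w_decreasing]) auto
    finally show ?thesis .
  qed
  have "((\<lambda>t. (1 - \<epsilon>) * (1 + \<epsilon>) * (1 + 4 * w t)) \<longlongrightarrow> (1 - \<epsilon>) * (1 + \<epsilon>) * (1 + 4 * 0)) at_top"
    by (intro tendsto_intros w_tendsto_zero)
  moreover have "((\<lambda>t::real. (1 - 1 / t) ^ n) \<longlongrightarrow> (1 - 0) ^ n) at_top"
    by (intro tendsto_intros tendsto_divide_0[OF tendsto_const] filterlim_at_top_imp_at_infinity filterlim_ident)
  ultimately have "((\<lambda>t. (1 - 1 / t) ^ n - (1 - \<epsilon>) * (1 + \<epsilon>) * (1 + 4 * w t)) \<longlongrightarrow>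
      (1 - 0) ^ n - (1 - \<epsilon>) * (1 + \<epsilon>) * (1 + 4 * 0)) at_top"
    by (rule tendsto_diff[rotated])
  moreover have "(1 - 0) ^ n - (1 - \<epsilon>) * (1 + \<epsilon>) * (1 + 4 * 0) > 0"
    using eps by (simp add: algebra_simps)
  ultimately have "eventually (\<lambda>t. (1 - 1 / t) ^ n - (1 - \<epsilon>) * (1 + \<epsilon>) * (1 + 4 * w t) > 0) at_top"
    by (rule order_tendstoD(1))
  then obtain T where "\<And>t. t \<ge> T \<Longrightarrow> (1 - 1 / t) ^ n - (1 - \<epsilon>) * (1 + \<epsilon>) * (1 + 4 * w t) > 0"
    unfolding eventually_at_top_linorder by blast
  then show ?thesis
    using step by (intro exI[of _ "max T (max 3 (1 + 1 / \<delta>))"]) fastforce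
qed

text \<open>The infinitely many solutions come from this plane. The restriction
  \<open>infnorm x >= 1\<close> keeps the arguments of \<open>w\<close> in the range where it is
  positive and decreasing.\<close>

lemma exists_sparse_plane:
  fixes w :: "real \<Rightarrow> real" and \<epsilon> :: real
  assumes dim: "CARD('n::finite) \<ge> 3"
    and w_pos: "\<And>t. t \<ge> 1 \<Longrightarrow> w t > 0"
    and w_decreasing: "antimono_on {1..} w"
    and w_tendsto_zero: "(w \<longlongrightarrow> 0) at_top"
    and w_ratio: "((\<lambda>\<delta>. SUP t\<in>{1..}. ereal (w t / w ((1 + \<delta>) * t))) \<longlongrightarrow> 1) (at 0)"
    and eps: "0 < \<epsilon>" "\<epsilon> < 1"
  shows "\<exists>B :: (real^'n) set. finite B \<and> independent B \<and>
    infinite {x \<in> zspan B. infnorm x \<ge> 1 \<and> coord_prod x \<le> w (infnorm x)} \<and>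
    finite {x \<in> zspan B. infnorm x \<ge> 1 \<and> coord_prod x \<le> (1 - \<epsilon>) * w (infnorm x)}"
proof -
  define d where "d = CARD('n)"
  have d: "d \<ge> 3" using dim by (simp add: d_def)
  obtain T where T: "T \<ge> 3" "\<And>t. t \<ge> T \<Longrightarrow> w (t - 1) \<le> (1 + \<epsilon>) * w t"
    "\<And>t. t \<ge> T \<Longrightarrow> (1 - \<epsilon>) * (1 + \<epsilon>) * (1 + 4 * w t) < (1 - 1 / t) ^ (d - 1)"
    using eventually_ratio_bounds[OF w_pos w_decreasing w_tendsto_zero w_ratio eps, of "d - 1"] by blast
  define Q where "Q = \<lceil>T\<rceil>"
  have QT: "real_of_int Q \<ge> T" by (simp add: Q_def)
  then have "Q \<ge> 3" using T(1) by linarith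
  note Q = QT this
  \<comment> \<open>The ceiling makes the next denominator about \<open>q^(d-1) / w q\<close>. The
    extra 3 meets the requirement on \<open>A\<close> and keeps \<open>q (Suc k) - q k\<close> above
    \<open>q^(d-1) / w q\<close>, so that the special points satisfy \<open>coord_prod <= w\<close>
    with no additional factor.\<close>
  define A where "A q = \<lceil>real_of_int q ^ (d - 2) / w q\<rceil> + 3" for q :: int
  have wq: "w (real_of_int q) > 0" if "q \<ge> Q" for q using that Q by (intro w_pos) simp
  have A3: "A q \<ge> 3" if "q \<ge> Q" for q
  proof -
    have "real_of_int q ^ (d - 2) / w q \<ge> 0" using wq[OF that] that Q by simp
    then have "\<lceil>real_of_int q ^ (d - 2) / w q\<rceil> \<ge> 0" by linarith
    then show ?thesis by (simp add: A_def)
  qed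
  have "Q \<ge> 2" using Q by simp
  obtain \<theta> :: real and p q :: "nat \<Rightarrow> int" and c :: real where
    \<theta>0: "\<theta> \<ge> 0" and c0: "c > 0" and qQ: "\<And>k. q k \<ge> Q" and qk: "\<And>k. q k \<ge> int k"
    and qlow: "\<And>k. (A (q k) - 1) * q k \<le> q (Suc k)" and qupp: "\<And>k. q (Suc k) \<le> A (q k) * q k"
    and \<delta>low: "\<And>k. 1 / q (Suc k) \<le> \<theta> * q k - p k" and \<delta>upp: "\<And>k. \<theta> * q k - p k \<le> 1 / (q (Suc k) - q k)"
    and bad: "\<And>(x::int) (y::int) (N::real). N \<ge> 1 \<Longrightarrow> N \<ge> \<bar>x\<bar> \<Longrightarrow>
       (\<exists>k m. x = m * q k \<and> y = m * p k) \<or> c \<le> \<bar>\<theta> * x - y\<bar> * N"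
    by (rule exists_prescribed_approximations[where A = A and Q = Q, OF A3 \<open>Q \<ge> 2\<close>])
      (assumption, rule that)

  obtain f :: "'n \<Rightarrow> nat" where f: "inj f"
    using finite_imp_inj_to_nat_seg[of "UNIV :: 'n set"] by auto
  \<comment> \<open>Adding distinct integers to \<open>sqrt 2\<close> keeps the slopes badly
    approximable and at distance at least 1 from each other.\<close>
  define s where "s j = sqrt 2 + real (f j)" for j
  have s1: "s j \<ge> 1" for j using real_sqrt_ge_1_iff[of 2] by (simp add: s_def add_increasing2)
  have s_diff: "\<bar>s i - s j\<bar> \<ge> 1" if "i \<noteq> j" for i j
  proof -
    have "f i \<noteq> f j" using f that by (auto dest: injD)
    then show ?thesis by (simp add: s_def)
  qed
  define M where "M = 2 + \<theta> + Max (range s)"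
  have sM: "s j + \<theta> + 2 \<le> M" for j by (simp add: M_def)
  have s\<theta>: "s j + \<theta> > 0" "s j + \<theta> \<le> M" for j using s1[of j] \<theta>0 sM[of j] by auto
  have M3: "M \<ge> 3" using sM[of undefined] s1[of undefined] \<theta>0 by linarith
  \<comment> \<open>\<open>undefined\<close> stands for an arbitrary index, the one whose coordinate
    is \<open>\<theta> x - y\<close>.\<close>
  define o1 :: 'n where "o1 = undefined"
  \<comment> \<open>Division by \<open>s j + \<theta>\<close> normalises the other forms: where
    \<open>y = \<theta> x - \<delta>\<close> their value is
    \<open>x - \<delta> / (s j + \<theta>)\<close>, hence within 1 of \<open>q k\<close> at a
    special point.\<close>
  define F where "F j x y = (if j = o1 then \<theta> * x - y else (s j * x + y) / (s j + \<theta>))" for j :: 'n and x y :: real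
  define V where "V x y = (\<chi> j. F j x y)" for x y
  have V_lin: "V x y = x *\<^sub>R V 1 0 + y *\<^sub>R V 0 1" for x y
    by (simp add: vec_eq_iff V_def F_def add_divide_distrib)
  have V_nth [simp]: "V x y $ j = F j x y" for x y j by (simp add: V_def)

  \<comment> \<open>Any two of the forms determine \<open>(x, y)\<close> with bounded coefficients,
    so at most one coordinate of \<open>V x y\<close> can be small compared with the larger of
    \<open>|x|\<close> and \<open>|y|\<close>.\<close>
  have sep_x: "\<bar>x\<bar> \<le> 2 * M\<^sup>2 * r" and sep_y: "\<bar>y\<bar> \<le> 2 * M\<^sup>2 * r"
    if ij: "i \<noteq> j" and r: "\<bar>F i x y\<bar> \<le> r" "\<bar>F j x y\<bar> \<le> r" for i j x y r
  proof -
    have r0: "r \<ge> 0" using r(1) by linarith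
    have MM: "M \<le> M\<^sup>2" using M3 by (simp add: power2_eq_square)
    have MM3: "3 * M \<le> M\<^sup>2" using M3 by (simp add: power2_eq_square)
    have gen: "\<bar>s j * x + y\<bar> \<le> M * r" if "j \<noteq> o1" "\<bar>F j x y\<bar> \<le> r" for j
    proof -
      have "\<bar>s j * x + y\<bar> = (s j + \<theta>) * \<bar>F j x y\<bar>" using s\<theta>[of j] that(1) by (simp add: F_def abs_mult)
      also have "\<dots> \<le> M * r" using s\<theta>[of j] that(2) by (intro mult_mono) auto
      finally show ?thesis .
    qed
    have mixed: "\<bar>x\<bar> \<le> 2 * M\<^sup>2 * r \<and> \<bar>y\<bar> \<le> 2 * M\<^sup>2 * r" if "j \<noteq> o1" "\<bar>F j x y\<bar> \<le> r" "\<bar>F o1 x y\<bar> \<le> r" for j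
    proof -
      have o: "\<bar>\<theta> * x - y\<bar> \<le> r" using that(3) by (simp add: F_def)
      have "\<bar>x\<bar> \<le> \<bar>(s j + \<theta>) * x\<bar>"
        using s1[of j] \<theta>0 mult_right_mono[of 1 "s j + \<theta>" "\<bar>x\<bar>"] by (simp add: abs_mult)
      also have "(s j + \<theta>) * x = (s j * x + y) + (\<theta> * x - y)" by (simp add: algebra_simps)
      also have "\<bar>\<dots>\<bar> \<le> M * r + r" using gen[OF that(1,2)] o by linarith
      finally have x: "\<bar>x\<bar> \<le> (M + 1) * r" by (simp add: algebra_simps)
      have "\<theta> \<le> M - 3" using sM[of j] s1[of j] by linarith
      then have "\<bar>\<theta> * x\<bar> \<le> (M - 3) * ((M + 1) * r)"
        using x \<theta>0 by (simp add: abs_mult mult_mono)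
      then have "\<bar>y\<bar> \<le> (M - 3) * ((M + 1) * r) + r" using o by linarith
      also have "\<dots> = ((M - 3) * (M + 1) + 1) * r" by (simp add: algebra_simps)
      also have "\<dots> \<le> 2 * M\<^sup>2 * r"
      proof (intro mult_right_mono r0)
        have "0 \<le> M\<^sup>2" by simp
        then show "(M - 3) * (M + 1) + 1 \<le> 2 * M\<^sup>2"
          using M3 by (simp add: algebra_simps power2_eq_square)
      qed
      finally have "\<bar>y\<bar> \<le> 2 * M\<^sup>2 * r" .
      moreover have "(M + 1) * r \<le> 2 * M\<^sup>2 * r" using r0 MM M3 by (intro mult_right_mono) auto
      ultimately show ?thesis using x by linarith
    qed
    have "\<bar>x\<bar> \<le> 2 * M\<^sup>2 * r \<and> \<bar>y\<bar> \<le> 2 * M\<^sup>2 * r"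
    proof (cases "i = o1 \<or> j = o1")
      case True
      then show ?thesis using mixed[of j] mixed[of i] ij r by auto
    next
      case False
      note gi = gen[of i] and gj = gen[of j]
      have b: "\<bar>s i * x + y\<bar> \<le> M * r" "\<bar>s j * x + y\<bar> \<le> M * r" using gi gj False r by auto
      have "\<bar>x\<bar> \<le> \<bar>(s i - s j) * x\<bar>"
        using s_diff[OF ij] mult_right_mono[of 1 "\<bar>s i - s j\<bar>" "\<bar>x\<bar>"] by (simp add: abs_mult)
      also have "(s i - s j) * x = (s i * x + y) - (s j * x + y)" by (simp add: algebra_simps)
      also have "\<bar>\<dots>\<bar> \<le> 2 * (M * r)" using b by linarith
      finally have x: "\<bar>x\<bar> \<le> 2 * (M * r)" .
      have "\<bar>y\<bar> \<le> \<bar>(s j - s i) * y\<bar>"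
        using s_diff[OF ij] mult_right_mono[of 1 "\<bar>s j - s i\<bar>" "\<bar>y\<bar>"] by (simp add: abs_mult abs_minus_commute)
      also have "(s j - s i) * y = s j * (s i * x + y) - s i * (s j * x + y)" by (simp add: algebra_simps)
      also have "\<bar>\<dots>\<bar> \<le> \<bar>s j * (s i * x + y)\<bar> + \<bar>s i * (s j * x + y)\<bar>" by (rule abs_triangle_ineq4)
      also have "\<dots> \<le> M * (M * r) + M * (M * r)"
        unfolding abs_mult using b s1[of i] s1[of j] s\<theta>(2)[of i] s\<theta>(2)[of j] \<theta>0
        by (intro add_mono mult_mono) auto
      finally have "\<bar>y\<bar> \<le> 2 * M\<^sup>2 * r" by (simp add: power2_eq_square)
      moreover have "2 * (M * r) \<le> 2 * M\<^sup>2 * r" using mult_right_mono[OF MM r0] by simp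
      ultimately show ?thesis using x by linarith
    qed
    then show "\<bar>x\<bar> \<le> 2 * M\<^sup>2 * r" "\<bar>y\<bar> \<le> 2 * M\<^sup>2 * r" by blast+
  qed
  obtain o2 :: 'n where o2: "o2 \<noteq> o1"
  proof -
    have "UNIV \<noteq> {o1}"
    proof
      assume "UNIV = {o1}"
      then have "CARD('n) = card {o1}" by simp
      then show False using dim by simp
    qed
    then show thesis using that by blast
  qed
  have V_inj: "x = 0 \<and> y = 0" if "V x y = 0" for x y
  proof -
    have z: "F j x y = 0" for j using arg_cong[OF that, of "\<lambda>v. v $ j"] by simp
    then show ?thesis using sep_x[OF o2, of x y 0] sep_y[OF o2, of x y 0] by simp
  qed
  define B where "B = {V 1 0, V 0 1}"
  have neq: "V 1 0 \<noteq> V 0 1"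
  proof
    assume "V 1 0 = V 0 1"
    then have "V 1 (-1) = 0" using V_lin[of 1 "-1"] by simp
    then show False using V_inj by fastforce
  qed
  have notspan: "V 1 0 \<notin> span {V 0 1}"
  proof
    assume "V 1 0 \<in> span {V 0 1}"
    then obtain k where "V 1 0 = k *\<^sub>R V 0 1" by (auto simp: span_singleton)
    then have "V 1 (-k) = 0" using V_lin[of 1 "-k"] by simp
    then show False using V_inj by fastforce
  qed
  have indep: "independent B"
    unfolding B_def using notspan neq V_inj[of 0 1] by (auto simp: independent_insert)
  have zB: "zspan B = {V (of_int x) (of_int y) | x y :: int. True}"
  proof -
    have "zspan B = {of_int m *\<^sub>R V 1 0 + l | m l. l \<in> zspan {V 0 1}}"
      unfolding B_def using neq by (intro zspan_insert) auto
    also have "zspan {V 0 1} = {of_int m *\<^sub>R V 0 1 + l | m l. l \<in> zspan {}}"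
      by (intro zspan_insert) auto
    finally have "zspan B = {of_int x *\<^sub>R V 1 0 + of_int y *\<^sub>R V 0 1 | x y :: int. True}" by auto
    then show ?thesis by (subst V_lin)
  qed

  define z where "z k = V (of_int (q k)) (of_int (p k))" for k
  \<comment> \<open>With \<open>t = q k\<close>, the coordinate \<open>o1\<close> is
    \<open>\<delta>\<close>, about \<open>w t / t^(d-1)\<close>, and the others have absolute value
    between \<open>t - 1\<close> and \<open>t\<close>. So the product lies between
    \<open>\<delta> (t-1)^(d-1)\<close> and \<open>\<delta> t^(d-1)\<close>.\<close>
  have special: "coord_prod (z k) \<le> w (infnorm (z k))" "(1 - \<epsilon>) * w (infnorm (z k)) < coord_prod (z k)"
    "infnorm (z k) \<ge> q k - 1" for k
  proof -
    define t where "t = real_of_int (q k)"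
    define \<delta> where "\<delta> = \<theta> * t - p k"
    have t: "t \<ge> T" "t \<ge> 3" using qQ[of k] Q T(1) unfolding t_def by linarith+
    have w: "w t > 0" using t by (intro w_pos) simp
    define q' where "q' = real_of_int (q (Suc k))"
    have tpow: "t ^ (d - 2) * t = t ^ (d - 1)"
    proof -
      have "d - 1 = Suc (d - 2)" using d by simp
      then show ?thesis by (simp add: mult.commute)
    qed
    have tp: "t \<le> t ^ (d - 1)" using t d self_le_power[of t "d - 1"] by simp
    have Alow: "t ^ (d - 2) / w t + 3 \<le> A (q k)" and Aupp: "A (q k) \<le> t ^ (d - 2) / w t + 4"
      unfolding A_def t_def of_int_add of_int_numeral by linarith+
    have "real_of_int ((A (q k) - 1) * q k) \<le> q'" unfolding q'_def using qlow[of k] by (simp only: of_int_le_iff)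
    then have "(A (q k) - 1) * t \<le> q'" by (simp add: t_def)
    moreover have "(t ^ (d - 2) / w t + 2) * t \<le> (A (q k) - 1) * t" using Alow t by (intro mult_right_mono) auto
    ultimately have q'low: "t ^ (d - 1) / w t + t \<le> q' - t" using tpow by (simp add: algebra_simps)
    have "q' \<le> real_of_int (A (q k) * q k)" unfolding q'_def using qupp[of k] by (simp only: of_int_le_iff)
    then have "q' \<le> A (q k) * t" by (simp add: t_def)
    also have "\<dots> \<le> (t ^ (d - 2) / w t + 4) * t" using Aupp t by (intro mult_right_mono) auto
    also have "\<dots> = t ^ (d - 1) / w t + 4 * t" using tpow by (simp add: algebra_simps)
    \<comment> \<open>This crude step turns the additive error into the factor
      \<open>1 + 4 w t\<close>, which tends to 1.\<close>
    also have "\<dots> \<le> t ^ (d - 1) / w t + 4 * t ^ (d - 1)" using tp by simp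
    also have "\<dots> = t ^ (d - 1) * (1 + 4 * w t) / w t" using w by (simp add: field_simps)
    finally have q'upp: "q' \<le> t ^ (d - 1) * (1 + 4 * w t) / w t" .
    have tpos: "t ^ (d - 1) > 0" using t by simp
    have q'pos: "q' > 0" "q' - t > 0" using q'low t w tpos by (smt (verit) divide_pos_pos)+
    have \<delta>1: "\<delta> \<ge> 1 / q'" using \<delta>low[of k] by (simp add: \<delta>_def t_def q'_def)
    have \<delta>2: "\<delta> \<le> 1 / (q' - t)" using \<delta>upp[of k] by (simp add: \<delta>_def t_def q'_def)
    have "1 / q' > 0" using q'pos by simp
    then have \<delta>pos: "\<delta> > 0" using \<delta>1 by linarith
    have "t ^ (d - 1) / w t > 0" using tpos w by simp
    then have "1 / (q' - t) \<le> 1 / t" "1 / (q' - t) \<le> 1 / (t ^ (d - 1) / w t)"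
      using q'low t by (intro frac_le; linarith)+
    then have \<delta>t: "\<delta> \<le> 1 / t" and \<delta>w: "\<delta> \<le> w t / t ^ (d - 1)" using \<delta>2 by simp_all
    have "1 / t \<le> 1" using t by simp
    then have \<delta>le1: "\<delta> \<le> 1" using \<delta>t by linarith
    have "w t / (t ^ (d - 1) * (1 + 4 * w t)) = 1 / (t ^ (d - 1) * (1 + 4 * w t) / w t)" by simp
    also have "\<dots> \<le> 1 / q'" using q'upp q'pos w tpos by (intro divide_left_mono) auto
    also have "\<dots> \<le> \<delta>" by (rule \<delta>1)
    finally have \<delta>w': "w t / (t ^ (d - 1) * (1 + 4 * w t)) \<le> \<delta>" .
    have z1: "z k $ o1 = \<delta>" by (simp add: z_def F_def \<delta>_def t_def)
    have zj: "t - 1 \<le> \<bar>z k $ j\<bar>" "\<bar>z k $ j\<bar> \<le> t" if "j \<noteq> o1" for j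
    proof -
      have "z k $ j = (s j * t + p k) / (s j + \<theta>)" using that by (simp add: z_def F_def t_def)
      also have "s j * t + p k = t * (s j + \<theta>) - \<delta>" by (simp add: \<delta>_def algebra_simps)
      also have "\<dots> / (s j + \<theta>) = t - \<delta> / (s j + \<theta>)" using s\<theta>(1)[of j] by (simp add: diff_divide_distrib)
      finally have e: "z k $ j = t - \<delta> / (s j + \<theta>)" .
      have "\<delta> / (s j + \<theta>) \<le> 1" using \<delta>le1 s1[of j] \<theta>0 by simp
      moreover have "\<delta> / (s j + \<theta>) \<ge> 0" using \<delta>pos s\<theta>(1)[of j] by simp
      ultimately show "t - 1 \<le> \<bar>z k $ j\<bar>" "\<bar>z k $ j\<bar> \<le> t" using t by (auto simp: e)
    qed
    have inf_low: "t - 1 \<le> infnorm (z k)"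
      using zj(1)[OF o2] component_le_infnorm_cart[of "z k" o2] by linarith
    then show "infnorm (z k) \<ge> q k - 1" by (simp add: t_def)
    have inf_upp: "infnorm (z k) \<le> t"
      unfolding infnorm_cart_le_iff
    proof
      fix j show "\<bar>z k $ j\<bar> \<le> t" using zj(2)[of j] z1 \<delta>pos \<delta>le1 t by (cases "j = o1") auto
    qed
    have cp: "coord_prod (z k) = \<delta> * (\<Prod>j\<in>UNIV - {o1}. \<bar>z k $ j\<bar>)"
      unfolding coord_prod_def using \<delta>pos by (subst prod.remove[of UNIV o1]) (auto simp: z1)
    have card: "card (UNIV - {o1}) = d - 1" by (simp add: d_def)
    have "(\<Prod>j\<in>UNIV - {o1}. \<bar>z k $ j\<bar>) \<le> (\<Prod>j\<in>UNIV - {o1}. t)"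
      using zj by (intro prod_mono) auto
    then have pu: "(\<Prod>j\<in>UNIV - {o1}. \<bar>z k $ j\<bar>) \<le> t ^ (d - 1)" by (simp add: card)
    have "(\<Prod>j\<in>UNIV - {o1}. t - 1) \<le> (\<Prod>j\<in>UNIV - {o1}. \<bar>z k $ j\<bar>)"
      using zj t by (intro prod_mono) auto
    then have pl: "(t - 1) ^ (d - 1) \<le> (\<Prod>j\<in>UNIV - {o1}. \<bar>z k $ j\<bar>)" by (simp add: card)
    have "coord_prod (z k) \<le> (w t / t ^ (d - 1)) * t ^ (d - 1)"
      unfolding cp using \<delta>w pu \<delta>pos w tpos by (intro mult_mono) (auto intro: prod_nonneg)
    also have "\<dots> = w t" using t by simp
    also have "\<dots> \<le> w (infnorm (z k))"
      using inf_low inf_upp t by (intro monotone_onD[OF w_decreasing]) auto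
    finally show "coord_prod (z k) \<le> w (infnorm (z k))" .
    have "w (infnorm (z k)) \<le> w (t - 1)"
      using inf_low t by (intro monotone_onD[OF w_decreasing]) auto
    also have "\<dots> \<le> (1 + \<epsilon>) * w t" using T(2) t by blast
    finally have "(1 - \<epsilon>) * w (infnorm (z k)) \<le> (1 - \<epsilon>) * ((1 + \<epsilon>) * w t)"
      using eps by (intro mult_left_mono) auto
    also have "\<dots> = w t / (1 + 4 * w t) * ((1 - \<epsilon>) * (1 + \<epsilon>) * (1 + 4 * w t))"
      using w by simp
    also have "\<dots> < w t / (1 + 4 * w t) * (1 - 1 / t) ^ (d - 1)"
      using T(3)[OF t(1)] w by (intro mult_strict_left_mono) auto
    also have "(1 - 1 / t) ^ (d - 1) = (t - 1) ^ (d - 1) / t ^ (d - 1)"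
      using t by (simp add: power_divide[symmetric] diff_divide_distrib)
    also have "w t / (1 + 4 * w t) * ((t - 1) ^ (d - 1) / t ^ (d - 1))
        = w t / (t ^ (d - 1) * (1 + 4 * w t)) * (t - 1) ^ (d - 1)" by simp
    also have "\<dots> \<le> coord_prod (z k)"
      unfolding cp using \<delta>w' pl \<delta>pos t by (intro mult_mono) auto
    finally show "(1 - \<epsilon>) * w (infnorm (z k)) < coord_prod (z k)" .
  qed
  have zone: "infnorm (z k) \<ge> 1" for k
    using special(3)[of k] qQ[of k] Q(2) by linarith
  have inf: "infinite {x \<in> zspan B. infnorm x \<ge> 1 \<and> coord_prod x \<le> w (infnorm x)}"
  proof
    assume fin: "finite {x \<in> zspan B. infnorm x \<ge> 1 \<and> coord_prod x \<le> w (infnorm x)}"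
    have sub: "range z \<subseteq> {x \<in> zspan B. infnorm x \<ge> 1 \<and> coord_prod x \<le> w (infnorm x)}"
      using special(1) zone unfolding zB z_def by blast
    \<comment> \<open>The \<open>z k\<close> take infinitely many values because their norms are
      unbounded, as \<open>q k >= k\<close>.\<close>
    have "finite (range (\<lambda>k. infnorm (z k)))"
      using finite_imageI[OF finite_subset[OF sub fin], of infnorm] by (simp add: image_image)
    then have "bdd_above (range (\<lambda>k. infnorm (z k)))" by (rule bdd_above_finite)
    then obtain R where R: "\<And>k. infnorm (z k) \<le> R" by (auto simp: bdd_above_def)
    obtain k where "R + 1 < real k" using reals_Archimedean2 by blast
    moreover have "real k \<le> q k" using qk[of k] by linarith
    ultimately show False using R[of k] special(3)[of k] by linarith
  qed
  define c' where "c' = min c (1 / (2 * M\<^sup>2))"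
  have c'0: "c' > 0" using c0 M3 by (simp add: c'_def)
  have fin: "finite {x \<in> zspan B. infnorm x \<ge> 1 \<and> coord_prod x \<le> (1 - \<epsilon>) * w (infnorm x)}"
  proof (rule finite_subset)
    \<comment> \<open>\<open>w 1 / c'^d\<close> will bound \<open>N\<close>, and
      \<open>infnorm v <= (M + 1) N\<close>.\<close>
    define R where "R = (M + 1) * (w 1 / c' ^ d)"
    show "{x \<in> zspan B. infnorm x \<ge> 1 \<and> coord_prod x \<le> (1 - \<epsilon>) * w (infnorm x)}
        \<subseteq> {x \<in> zspan B. infnorm x \<le> R}"
    proof
      fix v assume "v \<in> {x \<in> zspan B. infnorm x \<ge> 1 \<and> coord_prod x \<le> (1 - \<epsilon>) * w (infnorm x)}"
      then have v: "v \<in> zspan B" "infnorm v \<ge> 1" "coord_prod v \<le> (1 - \<epsilon>) * w (infnorm v)" by auto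
      obtain x y :: int where xy: "v = V x y" using v(1) unfolding zB by blast
      define N where "N = real_of_int (max \<bar>x\<bar> \<bar>y\<bar>)"
      have nz: "x \<noteq> 0 \<or> y \<noteq> 0"
      proof (rule ccontr)
        assume "\<not> (x \<noteq> 0 \<or> y \<noteq> 0)"
        then have "v = 0" using V_lin[of 0 0] by (simp add: xy)
        then show False using v(2) by (simp add: infnorm_0)
      qed
      then have "1 \<le> max \<bar>x\<bar> \<bar>y\<bar>" by auto
      then have N: "N \<ge> 1" "N \<ge> \<bar>x\<bar>" "N \<ge> \<bar>y\<bar>"
        unfolding N_def of_int_le_iff of_int_1_le_iff by simp_all
      have "w (infnorm v) > 0" using v(2) by (rule w_pos)
      then have "(1 - \<epsilon>) * w (infnorm v) \<le> 1 * w (infnorm v)"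
        using eps by (intro mult_right_mono) auto
      also have "w (infnorm v) \<le> w 1" using v(2) by (intro monotone_onD[OF w_decreasing]) auto
      finally have cw: "coord_prod v \<le> w 1" using v(3) by simp
      show "v \<in> {x \<in> zspan B. infnorm x \<le> R}"
      proof (cases "\<exists>k m. x = m * q k \<and> y = m * p k")
        case True
        then obtain k m where km: "x = m * q k" "y = m * p k" by blast
        \<comment> \<open>Passing from \<open>z k\<close> to \<open>m z k\<close> multiplies the
          product by \<open>|m|^d >= 1\<close> and does not increase \<open>w\<close> of the norm,
          so the strict inequality in \<open>special\<close> rules out every nonzero
          multiple.\<close>
        have vm: "v = real_of_int m *\<^sub>R z k"
          using V_lin[of x y] V_lin[of "q k" "p k"] by (simp add: xy z_def km scaleR_add_right)
        have "m \<noteq> 0" using nz km by auto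
        then have m: "\<bar>real_of_int m\<bar> \<ge> 1" by linarith
        have "coord_prod (z k) \<le> \<bar>real_of_int m\<bar> ^ d * coord_prod (z k)"
          using mult_right_mono[OF one_le_power[OF m, of d] coord_prod_nonneg[of "z k"]] by simp
        then have "coord_prod (z k) \<le> coord_prod v" by (simp add: vm coord_prod_scaleR d_def)
        moreover have "w (infnorm v) \<le> w (infnorm (z k))"
        proof -
          have "infnorm (z k) \<le> infnorm v"
            using mult_right_mono[OF m infnorm_pos_le[of "z k"]] by (simp add: vm infnorm_mul)
          then show ?thesis using zone[of k] by (intro monotone_onD[OF w_decreasing]) auto
        qed
        then have "(1 - \<epsilon>) * w (infnorm v) \<le> (1 - \<epsilon>) * w (infnorm (z k))"
          using eps by (intro mult_left_mono) auto
        ultimately have False using special(2)[of k] v(3) by linarith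
        then show ?thesis ..
      next
        case False
        \<comment> \<open>Off the special lines every coordinate is at least \<open>c' / N\<close>:
          at \<open>o1\<close> by the choice of \<open>\<theta>\<close>, elsewhere by
          \<open>sqrt2_form_lower_bound\<close>.\<close>
        have all_low: "c' \<le> \<bar>v $ j\<bar> * N" for j
        proof (cases "j = o1")
          case True
          then show ?thesis using bad[OF N(1,2), of y] False by (simp add: xy F_def c'_def)
        next
          case j: False
          have "1 \<le> \<bar>s j * x + y\<bar> * ((s j + 1) * N)"
            using sqrt2_form_lower_bound[of "int (f j)" x N y] N nz by (simp add: s_def)
          also have "\<bar>s j * x + y\<bar> = (s j + \<theta>) * \<bar>v $ j\<bar>"
            using s\<theta>(1)[of j] j by (simp add: xy F_def)
          also have "(s j + \<theta>) * \<bar>v $ j\<bar> * ((s j + 1) * N) = ((s j + \<theta>) * (s j + 1)) * (\<bar>v $ j\<bar> * N)"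
            by (simp add: mult_ac)
          also have "\<dots> \<le> (M * M) * (\<bar>v $ j\<bar> * N)"
            using s1[of j] s\<theta>[of j] sM[of j] \<theta>0 N(1) M3 by (intro mult_right_mono mult_mono) auto
          finally have "1 / (2 * M\<^sup>2) \<le> \<bar>v $ j\<bar> * N"
            using M3 by (simp add: field_simps power2_eq_square)
          then show ?thesis by (simp add: c'_def)
        qed
        \<comment> \<open>With \<open>i\<close> the smallest coordinate, \<open>sep_x\<close> and
          \<open>sep_y\<close> apply to \<open>j\<close>, \<open>i\<close> with \<open>r\<close>
          equal to the size of coordinate \<open>j\<close>; hence all coordinates other than
          \<open>i\<close> are at least \<open>c' N\<close>.\<close>
        obtain i where i: "\<And>j. \<bar>v $ i\<bar> \<le> \<bar>v $ j\<bar>"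
          using ex_min_if_finite[of "range (\<lambda>j. \<bar>v $ j\<bar>)"] by (auto simp: not_less)
        have others: "c' * N \<le> \<bar>v $ j\<bar>" if "j \<noteq> i" for j
        proof -
          have "\<bar>real_of_int x\<bar> \<le> 2 * M\<^sup>2 * \<bar>v $ j\<bar>" "\<bar>real_of_int y\<bar> \<le> 2 * M\<^sup>2 * \<bar>v $ j\<bar>"
            using sep_x[OF that, of x y "\<bar>v $ j\<bar>"] sep_y[OF that, of x y "\<bar>v $ j\<bar>"] i[of j] by (auto simp: xy)
          then have "N \<le> 2 * M\<^sup>2 * \<bar>v $ j\<bar>" by (auto simp: N_def max_def)
          then have "1 / (2 * M\<^sup>2) * N \<le> \<bar>v $ j\<bar>" using M3 by (simp add: field_simps)
          moreover have "c' * N \<le> 1 / (2 * M\<^sup>2) * N" using N(1) by (intro mult_right_mono) (auto simp: c'_def)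
          ultimately show ?thesis by linarith
        qed
        have card: "card (UNIV - {i}) = d - 1" by (simp add: d_def)
        have "(\<Prod>j\<in>UNIV - {i}. c' * N) \<le> (\<Prod>j\<in>UNIV - {i}. \<bar>v $ j\<bar>)"
          using others c'0 N(1) by (intro prod_mono) auto
        then have "(c' * N) ^ (d - 1) \<le> (\<Prod>j\<in>UNIV - {i}. \<bar>v $ j\<bar>)" by (simp add: card)
        moreover have "c' / N \<le> \<bar>v $ i\<bar>" using all_low[of i] N(1) by (simp add: field_simps)
        ultimately have "c' / N * (c' * N) ^ (d - 1) \<le> \<bar>v $ i\<bar> * (\<Prod>j\<in>UNIV - {i}. \<bar>v $ j\<bar>)"
          using c'0 N(1) by (intro mult_mono) auto
        also have "\<dots> = coord_prod v"
          unfolding coord_prod_def by (subst prod.remove[of UNIV i]) auto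
        also have "\<dots> \<le> w 1" by (rule cw)
        finally have le: "c' / N * (c' * N) ^ (d - 1) \<le> w 1" .
        \<comment> \<open>Here \<open>d >= 3\<close> enters: the left factor product is
          \<open>c'^d N^(d-2)\<close>, and \<open>N^(d-2) >= N\<close>.\<close>
        have "c' ^ d * N \<le> c' / N * (c' * N) ^ (d - 1)"
        proof -
          obtain e where e: "d = Suc (Suc (Suc e))" using d
            by (metis add_2_eq_Suc le_Suc_ex numeral_3_eq_3 add_Suc plus_nat.add_0)
          have "1 \<le> N ^ e" using N(1) by (rule one_le_power)
          then have "c' ^ d * N * 1 \<le> c' ^ d * N * N ^ e" using c'0 N(1) by (intro mult_left_mono) auto
          also have "\<dots> = c' / N * (c' * N) ^ (d - 1)"
            using N(1) by (simp add: e power_mult_distrib field_simps)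
          finally show ?thesis by simp
        qed
        then have "N \<le> w 1 / c' ^ d" using le c'0 by (simp add: field_simps)
        then have NR: "(M + 1) * N \<le> R" unfolding R_def using M3 by (intro mult_left_mono) auto
        have "infnorm v \<le> (M + 1) * N"
          unfolding infnorm_cart_le_iff
        proof
          fix j
          show "\<bar>v $ j\<bar> \<le> (M + 1) * N"
          proof (cases "j = o1")
            case True
            have "\<bar>\<theta> * x - y\<bar> \<le> \<theta> * \<bar>real_of_int x\<bar> + \<bar>real_of_int y\<bar>"
              using \<theta>0 abs_triangle_ineq4[of "\<theta> * x" "real_of_int y"] by (simp add: abs_mult)
            also have "\<dots> \<le> M * N + N"
              using N s\<theta>(2)[of j] s1[of j] \<theta>0 by (intro add_mono mult_mono) auto
            finally show ?thesis using True by (simp add: xy F_def algebra_simps)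
          next
            case False
            have "\<bar>v $ j\<bar> = \<bar>s j * x + y\<bar> / (s j + \<theta>)" using False s\<theta>(1)[of j] by (simp add: xy F_def)
            also have "\<dots> \<le> \<bar>s j * x + y\<bar> / 1"
              using s1[of j] \<theta>0 by (intro divide_left_mono) auto
            also have "\<dots> \<le> s j * \<bar>real_of_int x\<bar> + \<bar>real_of_int y\<bar>"
              using s1[of j] abs_triangle_ineq[of "s j * x" "real_of_int y"] by (simp add: abs_mult)
            also have "\<dots> \<le> M * N + N"
              using N s\<theta>(2)[of j] s1[of j] \<theta>0 by (intro add_mono mult_mono) auto
            finally show ?thesis by (simp add: algebra_simps)
          qed
        qed
        then show ?thesis using v(1) NR by simp
      qed
    qed
    show "finite {x \<in> zspan B. infnorm x \<le> R}"
      using indep by (intro finite_zspan_infnorm_le) (auto simp: B_def)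
  qed
  have "finite B" by (simp add: B_def)
  then show ?thesis using indep inf fin by blast
qed

section \<open>From the plane to the full lattice\<close>

theorem theorem2:
  fixes w :: "real \<Rightarrow> real" and \<epsilon> :: real
  assumes dim: "CARD('n::finite) \<ge> 3"
    and w_pos: "\<And>t. t \<ge> 1 \<Longrightarrow> w t > 0"
    and w_decreasing: "antimono_on {1..} w"
    and w_tendsto_zero: "(w \<longlongrightarrow> 0) at_top"
    and w_ratio: "((\<lambda>\<delta>. SUP t\<in>{1..}. ereal (w t / w ((1 + \<delta>) * t))) \<longlongrightarrow> 1) (at 0)"
    and w_series: "summable (\<lambda>k. real (Suc k) ^ (CARD('n) - 1) * w (2 ^ Suc k))"
    and eps: "\<epsilon> > 0"
  shows "\<exists>L :: (real ^ 'n) set. is_lattice L \<and>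
    infinite {x \<in> L. coord_prod x \<le> (1 + \<epsilon>) * w (infnorm x)} \<and>
    finite {x \<in> L. coord_prod x \<le> (1 - \<epsilon>) * w (infnorm x)}"
proof -
  \<comment> \<open>The plane is built with a parameter below 1; shrinking \<epsilon> only
    strengthens finiteness, since \<open>1 - \<epsilon> <= 1 - \<eta>\<close>.\<close>
  define \<eta> where "\<eta> = min \<epsilon> (1/2)"
  have \<eta>: "0 < \<eta>" "\<eta> < 1" "\<eta> \<le> \<epsilon>" using eps by (auto simp: \<eta>_def)
  obtain B :: "(real^'n) set" where B: "finite B" "independent B"
    "infinite {x \<in> zspan B. infnorm x \<ge> 1 \<and> coord_prod x \<le> w (infnorm x)}"
    "finite {x \<in> zspan B. infnorm x \<ge> 1 \<and> coord_prod x \<le> (1 - \<eta>) * w (infnorm x)}"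
    using exists_sparse_plane[OF dim w_pos w_decreasing w_tendsto_zero w_ratio \<eta>(1,2)] by blast
  have dim2: "CARD('n) \<ge> 2" using dim by simp
  obtain B' where B': "finite B'" "independent B'" "card B' = CARD('n)" "zspan B \<subseteq> zspan B'"
    "finite {x \<in> zspan B' - zspan B. coord_prod x \<le> w (infnorm x)}"
    using exists_basis_sparse[OF dim2 B(1,2) w_pos w_decreasing w_series] by blast
  have fin1: "finite {x \<in> zspan B'. infnorm x \<le> 1}"
    by (rule finite_zspan_infnorm_le[OF B'(1,2)])
  have "{x \<in> zspan B. infnorm x \<ge> 1 \<and> coord_prod x \<le> w (infnorm x)}
      \<subseteq> {x \<in> zspan B'. coord_prod x \<le> (1 + \<epsilon>) * w (infnorm x)}"
  proof
    fix x assume "x \<in> {x \<in> zspan B. infnorm x \<ge> 1 \<and> coord_prod x \<le> w (infnorm x)}"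
    then have x: "x \<in> zspan B" "infnorm x \<ge> 1" "coord_prod x \<le> w (infnorm x)" by auto
    have "1 * w (infnorm x) \<le> (1 + \<epsilon>) * w (infnorm x)"
      using w_pos[OF x(2)] eps by (intro mult_right_mono) auto
    then show "x \<in> {x \<in> zspan B'. coord_prod x \<le> (1 + \<epsilon>) * w (infnorm x)}" using x B'(4) by auto
  qed
  then have inf: "infinite {x \<in> zspan B'. coord_prod x \<le> (1 + \<epsilon>) * w (infnorm x)}"
    using B(3) finite_subset by blast
  \<comment> \<open>Three finite sets: short vectors, including those of norm below 1 where
    \<open>w\<close> is not controlled; points of the plane; points added outside the plane.\<close>
  have "{x \<in> zspan B'. coord_prod x \<le> (1 - \<epsilon>) * w (infnorm x)}
      \<subseteq> {x \<in> zspan B'. infnorm x \<le> 1}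
        \<union> {x \<in> zspan B. infnorm x \<ge> 1 \<and> coord_prod x \<le> (1 - \<eta>) * w (infnorm x)}
        \<union> {x \<in> zspan B' - zspan B. coord_prod x \<le> w (infnorm x)}"
  proof
    fix x assume "x \<in> {x \<in> zspan B'. coord_prod x \<le> (1 - \<epsilon>) * w (infnorm x)}"
    then have x: "x \<in> zspan B'" "coord_prod x \<le> (1 - \<epsilon>) * w (infnorm x)" by auto
    show "x \<in> {x \<in> zspan B'. infnorm x \<le> 1}
        \<union> {x \<in> zspan B. infnorm x \<ge> 1 \<and> coord_prod x \<le> (1 - \<eta>) * w (infnorm x)}
        \<union> {x \<in> zspan B' - zspan B. coord_prod x \<le> w (infnorm x)}"
    proof (cases "infnorm x \<ge> 1")
      case True
      have "(1 - \<epsilon>) * w (infnorm x) \<le> (1 - \<eta>) * w (infnorm x)"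
        "(1 - \<epsilon>) * w (infnorm x) \<le> 1 * w (infnorm x)"
        using w_pos[OF True] \<eta> by (intro mult_right_mono; simp)+
      then show ?thesis using x True by auto
    qed (use x in auto)
  qed
  then have "finite {x \<in> zspan B'. coord_prod x \<le> (1 - \<epsilon>) * w (infnorm x)}"
    using fin1 B(4) B'(5) by (meson finite_UnI finite_subset)
  then show ?thesis
    using is_lattice_zspan[OF B'(1,2,3)] inf by blast
qed

end
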